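(* Let $m,n\ge 2$ and $1\le k\le m$ be integers, let $\alpha\in\mathbb{R}$ and $B\in M_{m,n}$, and let $\Phi^{+}_{\alpha,B}:M_n\to M_m$ be $\Phi^{+}_{\alpha,B}(X)=\alpha\,\mathrm{tr}(X)I_m+BXB^*$. The following are equivalent: (i) $\Phi^{+}_{\alpha,B}$ is $k$-PPT; (ii) $\Phi^{+}_{\alpha,B}$ is $k$-copositive; (iii) $\alpha\ge 0$ if $k=1$ or $\mathrm{rank}(B)\le 1$, and $\alpha\ge\sigma_1(B)\sigma_2(B)$ otherwise.
   Context: $M_{m,n}$ is the set of $m\times n$ complex matrices, $M_n=M_{n,n}$. Singular values of $B$ are $\sigma_1(B)\ge\sigma_2(B)\ge\cdots\ge\sigma_{\min\{m,n\}}(B)\ge 0$. For a block matrix $A=[A_{ij}]_{i,j=1}^k$ with square blocks, the partial transpose is $A^\tau=[A_{ji}]_{i,j=1}^k$ (blocks are swapped but not themselves transposed); $A$ is PPT if both $A$ and $A^\tau$ are positive semidefinite. Let $\Phi:M_n\to M_m$ be linear. $\Phi$ is $k$-positive if $[\Phi(A_{ij})]_{i,j=1}^k$ is positive semidefinite for every positive semidefinite $[A_{ij}]_{i,j=1}^k$ with $A_{ij}\in M_n$. $\Phi$ is $k$-copositive if $\Phi\circ\mathbf{T}$ is $k$-positive, where $\mathbf{T}(A)=A^\top$ on $M_n$. $\Phi$ is $k$-PPT if $[\Phi(A_{ij})]_{i,j=1}^k$ is PPT for every positive semidefinite $[A_{ij}]_{i,j=1}^k$ with $A_{ij}\in M_n$.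 *)

theory Defs
  imports
    "Jordan_Normal_Form.Char_Poly"
    "Jordan_Normal_Form.Schur_Decomposition"
    "Jordan_Normal_Form.DL_Rank"
    "HOL-Library.Multiset"
begin

definition mat_trace :: "complex mat \<Rightarrow> complex" where
  "mat_trace A = (\<Sum>i<dim_row A. A $$ (i, i))"

text \<open>The condition \<open>0 \<le> z\<close> on complex numbers, from \<^theory>\<open>HOL-Library.Complex_Order\<close>,
  says that \<open>z\<close> is real and nonnegative.\<close>

definition psd :: "complex mat \<Rightarrow> bool" where
  "psd A \<longleftrightarrow> square_mat A \<and> mat_adjoint A = A \<and>
     (\<forall>x \<in> carrier_vec (dim_row A). 0 \<le> (A *\<^sub>v x) \<bullet>c x)"

text \<open>The singular values of an \<open>m \<times> n\<close> matrix \<open>B\<close> are the \<open>min m n\<close> largest among the square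
  roots of the eigenvalues of \<open>B\<^sup>* B\<close>, with multiplicity, in decreasing order. The eigenvalues are
  real and nonnegative, so \<open>Re\<close> loses nothing. The index of \<open>singular_value\<close> is one-based.\<close>

definition singular_values :: "complex mat \<Rightarrow> real list" where
  "singular_values B = take (min (dim_row B) (dim_col B))
     (rev (sorted_list_of_multiset
       (image_mset (\<lambda>z. sqrt (Re z)) (proots (char_poly (mat_adjoint B * B))))))"

definition singular_value :: "nat \<Rightarrow> complex mat \<Rightarrow> real" where
  "singular_value i B = singular_values B ! (i - 1)"

text \<open>A block matrix \<open>[A\<^sub>i\<^sub>j]\<close> with \<open>k \<times> k\<close> blocks of size \<open>d \<times> d\<close> is given by its family of blocks,
  of which only those with \<open>i, j < k\<close> matter; \<open>block_mat d k A\<close> is the resulting \<open>kd \<times> kd\<close>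
  matrix.\<close>

definition block_mat :: "nat \<Rightarrow> nat \<Rightarrow> (nat \<Rightarrow> nat \<Rightarrow> complex mat) \<Rightarrow> complex mat" where
  "block_mat d k A =
     mat (k * d) (k * d) (\<lambda>(r, c). A (r div d) (c div d) $$ (r mod d, c mod d))"

definition partial_transpose :: "(nat \<Rightarrow> nat \<Rightarrow> complex mat) \<Rightarrow> nat \<Rightarrow> nat \<Rightarrow> complex mat" where
  "partial_transpose A = (\<lambda>i j. A j i)"

definition PPT :: "nat \<Rightarrow> nat \<Rightarrow> (nat \<Rightarrow> nat \<Rightarrow> complex mat) \<Rightarrow> bool" where
  "PPT d k A \<longleftrightarrow> psd (block_mat d k A) \<and> psd (block_mat d k (partial_transpose A))"

definition psd_blocks :: "nat \<Rightarrow> nat \<Rightarrow> (nat \<Rightarrow> nat \<Rightarrow> complex mat) \<Rightarrow> bool" where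
  "psd_blocks d k A \<longleftrightarrow> (\<forall>i<k. \<forall>j<k. A i j \<in> carrier_mat d d) \<and> psd (block_mat d k A)"

text \<open>A map \<open>M\<^sub>n \<rightarrow> M\<^sub>m\<close> is a function on all complex matrices, constrained and used only on
  \<open>carrier_mat n n\<close>.\<close>

definition linear_mat_map :: "nat \<Rightarrow> nat \<Rightarrow> (complex mat \<Rightarrow> complex mat) \<Rightarrow> bool" where
  "linear_mat_map n m \<Phi> \<longleftrightarrow>
     (\<forall>X \<in> carrier_mat n n. \<Phi> X \<in> carrier_mat m m) \<and>
     (\<forall>X \<in> carrier_mat n n. \<forall>Y \<in> carrier_mat n n. \<Phi> (X + Y) = \<Phi> X + \<Phi> Y) \<and>
     (\<forall>c. \<forall>X \<in> carrier_mat n n. \<Phi> (c \<cdot>\<^sub>m X) = c \<cdot>\<^sub>m \<Phi> X)"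

definition k_positive :: "nat \<Rightarrow> nat \<Rightarrow> nat \<Rightarrow> (complex mat \<Rightarrow> complex mat) \<Rightarrow> bool" where
  "k_positive n m k \<Phi> \<longleftrightarrow> linear_mat_map n m \<Phi> \<and>
     (\<forall>A. psd_blocks n k A \<longrightarrow> psd (block_mat m k (\<lambda>i j. \<Phi> (A i j))))"

definition k_copositive :: "nat \<Rightarrow> nat \<Rightarrow> nat \<Rightarrow> (complex mat \<Rightarrow> complex mat) \<Rightarrow> bool" where
  "k_copositive n m k \<Phi> \<longleftrightarrow> linear_mat_map n m \<Phi> \<and> k_positive n m k (\<Phi> \<circ> transpose_mat)"

definition k_PPT :: "nat \<Rightarrow> nat \<Rightarrow> nat \<Rightarrow> (complex mat \<Rightarrow> complex mat) \<Rightarrow> bool" where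
  "k_PPT n m k \<Phi> \<longleftrightarrow> linear_mat_map n m \<Phi> \<and>
     (\<forall>A. psd_blocks n k A \<longrightarrow> PPT m k (\<lambda>i j. \<Phi> (A i j)))"

definition Phi_plus :: "real \<Rightarrow> complex mat \<Rightarrow> complex mat \<Rightarrow> complex mat" where
  "Phi_plus \<alpha> B X =
     (complex_of_real \<alpha> * mat_trace X) \<cdot>\<^sub>m 1\<^sub>m (dim_row B) + B * X * mat_adjoint B"

lemma mat_adjoint_carrier:
  assumes "B \<in> carrier_mat m n"
  shows "mat_adjoint B \<in> carrier_mat n m"
  using assms unfolding mat_adjoint_def by auto

lemma linear_mat_map_Phi_plus:
  assumes B: "B \<in> carrier_mat m n"
  shows "linear_mat_map n m (Phi_plus \<alpha> B)"
proof -
  note Bs = mat_adjoint_carrier[OF B]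
  have dB: "dim_row B = m" using B by simp
  have dBs: "dim_col (mat_adjoint B) = m" using Bs by simp
  have carr: "Phi_plus \<alpha> B X \<in> carrier_mat m m" if "X \<in> carrier_mat n n" for X
    using that B Bs unfolding Phi_plus_def dB by auto
  have add: "Phi_plus \<alpha> B (X + Y) = Phi_plus \<alpha> B X + Phi_plus \<alpha> B Y"
    if X: "X \<in> carrier_mat n n" and Y: "Y \<in> carrier_mat n n" for X Y
  proof -
    have t: "mat_trace (X + Y) = mat_trace X + mat_trace Y"
      using X Y by (auto simp: mat_trace_def sum.distrib)
    have "B * (X + Y) * mat_adjoint B = (B * X + B * Y) * mat_adjoint B"
      using mult_add_distrib_mat[OF B X Y] by simp
    also have "\<dots> = B * X * mat_adjoint B + B * Y * mat_adjoint B"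
      using B X Y Bs by (intro add_mult_distrib_mat[where nr = m and n = n and nc = m]) auto
    finally have p: "B * (X + Y) * mat_adjoint B = B * X * mat_adjoint B + B * Y * mat_adjoint B" .
    have "B * X * mat_adjoint B \<in> carrier_mat m m" "B * Y * mat_adjoint B \<in> carrier_mat m m"
      using B X Y Bs by auto
    then show ?thesis
      unfolding Phi_plus_def dB t p by (intro eq_matI) (auto simp: algebra_simps dB dBs)
  qed
  have smult: "Phi_plus \<alpha> B (c \<cdot>\<^sub>m X) = c \<cdot>\<^sub>m Phi_plus \<alpha> B X" if X: "X \<in> carrier_mat n n" for c X
  proof -
    have t: "mat_trace (c \<cdot>\<^sub>m X) = c * mat_trace X"
      using X by (auto simp: mat_trace_def sum_distrib_left)
    have BX: "B * X \<in> carrier_mat m n" using B X by auto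
    have p: "B * (c \<cdot>\<^sub>m X) * mat_adjoint B = c \<cdot>\<^sub>m (B * X * mat_adjoint B)"
      using mult_smult_distrib[OF B X, of c] mult_smult_assoc_mat[OF BX Bs, of c] by simp
    have "B * X * mat_adjoint B \<in> carrier_mat m m" using BX Bs by auto
    then show ?thesis
      unfolding Phi_plus_def dB t p by (intro eq_matI) (auto simp: algebra_simps dB dBs)
  qed
  show ?thesis unfolding linear_mat_map_def using carr add smult by blast
qed

end

theory Submission
  imports Defs "HOL-Combinatorics.Permutations"
begin

text \<open>Up to a full transposition of the argument, \<open>k\<close>-copositivity says that the partial transpose of
  \<open>[\<Phi>(A\<^sub>i\<^sub>j)]\<close> is positive semidefinite, and a positive semidefinite \<open>A\<close> is a sum of blocks
  \<open>v\<^sub>i v\<^sub>j\<^sup>*\<close>. For one such term the quadratic form of the partial transpose at \<open>x\<close> depends only on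
  \<open>Z = \<Sum>\<^sub>j x\<^sub>j v\<^sub>j\<^sup>T\<close>. Let \<open>e\<^sub>p\<close> be an orthonormal eigenbasis of \<open>B\<^sup>* B\<close>, so that the vectors
  \<open>b\<^sub>p = B e\<^sub>p\<close> are orthogonal with \<open>\<parallel>b\<^sub>p\<parallel> = \<sigma>\<^sub>p\<close>. If \<open>z\<^sub>p\<close> are the columns of \<open>Z\<close> in this basis and
  \<open>t\<^sub>p\<^sub>q = \<langle>b\<^sub>q, z\<^sub>p\<rangle>\<close>, the form is \<open>\<alpha> \<Sum>\<^sub>p \<parallel>z\<^sub>p\<parallel>\<^sup>2 + \<Sum>\<^sub>p\<^sub>q t\<^sub>p\<^sub>q cnj t\<^sub>q\<^sub>p\<close>.
  By Bessel, \<open>\<parallel>z\<^sub>p\<parallel>\<^sup>2 \<ge> \<Sum>\<^sub>q \<bar>t\<^sub>p\<^sub>q\<bar>\<^sup>2 / \<sigma>\<^sub>q\<^sup>2\<close>, and by AM-GM on the pairs \<open>{p, q}\<close> it is nonnegative as soon as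
  \<open>\<alpha> \<ge> \<sigma>\<^sub>p \<sigma>\<^sub>q\<close> for all \<open>p \<noteq> q\<close>. The rank two choice \<open>z\<^sub>p = b\<^sub>q / \<sigma>\<^sub>q\<close>, \<open>z\<^sub>q = - b\<^sub>p / \<sigma>\<^sub>p\<close>
  shows that the bound is sharp.\<close>

section \<open>The spectral theorem\<close>

text \<open>Vectors are functions of which only the values below \<open>n\<close> matter, so no
  carrier conditions arise. The first argument is the conjugated one, whereas
  \<open>\<bullet>c\<close> conjugates the second.\<close>

definition cip :: "nat \<Rightarrow> (nat \<Rightarrow> complex) \<Rightarrow> (nat \<Rightarrow> complex) \<Rightarrow> complex" where
  "cip n x y = (\<Sum>a<n. cnj (x a) * y a)"

definition orthonormal :: "nat \<Rightarrow> (nat \<Rightarrow> nat \<Rightarrow> complex) \<Rightarrow> bool" where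
  "orthonormal n e \<longleftrightarrow> (\<forall>p<n. \<forall>q<n. cip n (e p) (e q) = (if p = q then 1 else 0))"

lemma cip_commute: "cnj (cip n x y) = cip n y x"
  by (simp add: cip_def mult.commute)

lemma cip_self: "cip n x x = complex_of_real (\<Sum>a<n. (cmod (x a))\<^sup>2)"
  unfolding cip_def of_real_sum
  by (intro sum.cong refl) (metis complex_norm_square mult.commute)

lemma cip_cong: "(\<And>a. a < n \<Longrightarrow> x a = x' a) \<Longrightarrow> (\<And>a. a < n \<Longrightarrow> y a = y' a) \<Longrightarrow> cip n x y = cip n x' y'"
  by (simp add: cip_def)

lemma cip_sum_right: "cip n x (\<lambda>a. \<Sum>i\<in>I. c i * y i a) = (\<Sum>i\<in>I. c i * cip n x (y i))"
  unfolding cip_def sum_distrib_left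
  by (subst sum.swap) (simp add: mult_ac)

lemma cip_sum_left: "cip n (\<lambda>a. \<Sum>i\<in>I. c i * y i a) x = (\<Sum>i\<in>I. cnj (c i) * cip n (y i) x)"
  unfolding cip_def sum_distrib_left cnj_sum sum_distrib_right
  by (subst sum.swap) (simp add: mult_ac)

lemma sum_delta_mult:
  "p < (n::nat) \<Longrightarrow> (\<Sum>i<n. (if i = p then 1 else 0) * f i) = (f p :: complex)"
  "p < (n::nat) \<Longrightarrow> (\<Sum>i<n. (if p = i then 1 else 0) * f i) = (f p :: complex)"
  "p < (n::nat) \<Longrightarrow> (\<Sum>i<n. f i * (if i = p then 1 else 0)) = (f p :: complex)"
  "p < (n::nat) \<Longrightarrow> (\<Sum>i<n. f i * (if p = i then 1 else 0)) = (f p :: complex)"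
  by (simp_all add: if_distrib[of "\<lambda>x. x * _"] if_distrib[of "\<lambda>x. _ * x"] cong: if_cong)

lemma orthonormalD:
  "orthonormal n e \<Longrightarrow> p < n \<Longrightarrow> q < n \<Longrightarrow> cip n (e p) (e q) = (if p = q then 1 else 0)"
  by (simp add: orthonormal_def)

definition matfun :: "nat \<Rightarrow> (nat \<Rightarrow> nat \<Rightarrow> complex) \<Rightarrow> complex mat" where
  "matfun n f = mat n n (\<lambda>(a, b). f a b)"

text \<open>Orthonormality makes the conjugate transpose a left inverse of a square matrix, and a
  left inverse is two-sided. The second equation is the completeness relation.\<close>

lemma orthonormal_inverse:
  assumes "orthonormal n e"
  shows "matfun n (\<lambda>p a. cnj (e p a)) * matfun n (\<lambda>a p. e p a) = 1\<^sub>m n"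
    "matfun n (\<lambda>a p. e p a) * matfun n (\<lambda>p a. cnj (e p a)) = 1\<^sub>m n"
proof -
  show l: "matfun n (\<lambda>p a. cnj (e p a)) * matfun n (\<lambda>a p. e p a) = 1\<^sub>m n"
    using orthonormalD[OF assms] unfolding cip_def
    by (intro eq_matI) (auto simp: matfun_def scalar_prod_def atLeast0LessThan)
  show "matfun n (\<lambda>a p. e p a) * matfun n (\<lambda>p a. cnj (e p a)) = 1\<^sub>m n"
    by (rule mat_mult_left_right_inverse[OF _ _ l]) (auto simp: matfun_def)
qed

lemma orthonormal_complete:
  assumes "orthonormal n e" "a < n" "b < n"
  shows "(\<Sum>p<n. e p a * cnj (e p b)) = (if a = b then 1 else 0)"
  using arg_cong[OF orthonormal_inverse(2)[OF assms(1)], of "\<lambda>M. M $$ (a, b)"] assms(2,3)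
  by (simp add: matfun_def scalar_prod_def atLeast0LessThan)

lemma orthonormal_expand:
  assumes "orthonormal n e" "a < n"
  shows "y a = (\<Sum>p<n. cip n (e p) y * e p a)"
proof -
  have "(\<Sum>p<n. cip n (e p) y * e p a) = (\<Sum>p<n. \<Sum>b<n. (e p a * cnj (e p b)) * y b)"
    unfolding cip_def sum_distrib_right by (simp only: mult_ac)
  also have "\<dots> = (\<Sum>b<n. (\<Sum>p<n. e p a * cnj (e p b)) * y b)"
    by (subst sum.swap) (simp add: sum_distrib_right)
  also have "\<dots> = (\<Sum>b<n. (if a = b then 1 else 0) * y b)"
    by (intro sum.cong refl) (simp add: orthonormal_complete[OF assms(1,2)])
  also have "\<dots> = y a" using assms(2) by (rule sum_delta_mult)
  finally show ?thesis by simp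
qed

text \<open>A complex characteristic polynomial has a root; Gram-Schmidt on a basis that starts with
  an eigenvector leaves that vector first. This supplies the deflation step of the spectral
  theorem.\<close>

lemma orthonormal_with_eigenvector:
  assumes A: "A \<in> carrier_mat n n" and n: "0 < n"
  obtains w \<mu> where "orthonormal n w" "\<And>a. a < n \<Longrightarrow> (\<Sum>b<n. A $$ (a, b) * w 0 b) = \<mu> * w 0 a"
proof -
  from char_poly_factorized[OF A] obtain as where
    as: "char_poly A = (\<Prod>a\<leftarrow>as. [:- a, 1:])" "length as = n" by blast
  with n obtain \<mu> where "poly (char_poly A) \<mu> = 0" by (cases as) auto
  then have "eigenvalue A \<mu>" using eigenvalue_root_char_poly[OF A] by simp
  then obtain v where "eigenvector A v \<mu>" unfolding eigenvalue_def by blast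
  then have v: "v \<in> carrier_vec n" "v \<noteq> 0\<^sub>v n" and ev: "A *\<^sub>v v = \<mu> \<cdot>\<^sub>v v"
    using A unfolding eigenvector_def by auto
  interpret cof_vec_space n "TYPE(complex)" .
  define ws where "ws = gram_schmidt n (basis_completion v)"
  note bc = basis_completion[OF v]
  from gram_schmidt_result[OF bc(2,4,5) refl, folded ws_def]
  have ws: "set ws \<subseteq> carrier_vec n" "corthogonal ws" "length ws = n"
    using bc(6) by auto
  obtain vs where vs: "basis_completion v = v # vs"
    using bc(6,7) n by (cases "basis_completion v") auto
  have hd: "ws ! 0 = v"
    using gram_schmidt_hd[OF v(1), of vs] ws(3) n hd_conv_nth[of ws]
    unfolding ws_def vs by force
  \<comment> \<open>Gram-Schmidt gives orthogonal nonzero vectors; \<open>c p\<close> is the norm by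
    which the vector at position \<open>p\<close> is divided.\<close>
  define c where "c p = complex_of_real (sqrt (\<Sum>a<n. (cmod (ws ! p $ a))\<^sup>2))" for p
  define w where "w p a = (1 / c p) * ws ! p $ a" for p a
  have wsc: "ws ! p \<in> carrier_vec n" if "p < n" for p using ws that by auto
  have dot: "cip n (\<lambda>a. ws ! p $ a) (\<lambda>a. ws ! q $ a) = ws ! q \<bullet>c ws ! p" if "p < n" "q < n" for p q
    using wsc[OF that(1)] wsc[OF that(2)]
    by (auto simp: cip_def scalar_prod_def atLeast0LessThan mult_ac)
  have cc: "c p * c p = cip n (\<lambda>a. ws ! p $ a) (\<lambda>a. ws ! p $ a)" for p
    unfolding c_def cip_self of_real_mult[symmetric]
    by (subst real_sqrt_mult_self) (simp add: sum_nonneg)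
  have c0: "c p \<noteq> 0" if "p < n" for p
    using cc[of p] dot[OF that that] corthogonalD[OF ws(2), of p p] that ws(3) by auto
  have "orthonormal n w" unfolding orthonormal_def
  proof (intro allI impI)
    fix p q assume p: "p < n" and q: "q < n"
    have "cip n (w p) (w q) = (1 / (c p * c q)) * cip n (\<lambda>a. ws ! p $ a) (\<lambda>a. ws ! q $ a)"
      unfolding cip_def w_def c_def by (simp add: sum_distrib_left sum_divide_distrib mult_ac)
    then show "cip n (w p) (w q) = (if p = q then 1 else 0)"
      using cc[of p] c0[OF p] dot[OF p q] corthogonalD[OF ws(2), of q p] p q ws(3) by auto
  qed
  moreover have "(\<Sum>b<n. A $$ (a, b) * w 0 b) = \<mu> * w 0 a" if a: "a < n" for a
  proof -
    have "(\<Sum>b<n. A $$ (a, b) * v $ b) = \<mu> * v $ a"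
      using arg_cong[OF ev, of "\<lambda>u. u $ a"] a A v(1)
      by (simp add: scalar_prod_def atLeast0LessThan)
    moreover have "(\<Sum>b<n. A $$ (a, b) * w 0 b) = 1 / c 0 * (\<Sum>b<n. A $$ (a, b) * v $ b)"
      unfolding w_def hd by (simp add: sum_distrib_left sum_divide_distrib mult_ac)
    ultimately show ?thesis unfolding w_def hd by simp
  qed
  ultimately show thesis by (rule that)
qed

text \<open>Deflation: the orthogonal complement of an eigenvector is invariant under a self-adjoint
  map, and eigenvectors of the compression to it lift back. Taking \<open>A\<close> as a function
  lets the induction apply directly to the compression.\<close>

lemma hermitian_eigenbasis:
  assumes "\<And>a b. a < n \<Longrightarrow> b < n \<Longrightarrow> cnj (A a b) = A b a"
  shows "\<exists>e t. orthonormal n e \<and> (\<forall>p<n. \<forall>a<n. (\<Sum>b<n. A a b * e p b) = t p * e p a)"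
  using assms
proof (induction n arbitrary: A)
  case 0
  then show ?case by (simp add: orthonormal_def)
next
  case (Suc r)
  let ?n = "Suc r"
  obtain w \<mu> where w: "orthonormal ?n w"
    and ev: "\<And>a. a < ?n \<Longrightarrow> (\<Sum>b<?n. matfun ?n A $$ (a, b) * w 0 b) = \<mu> * w 0 a"
    using orthonormal_with_eigenvector[of "matfun ?n A" ?n] unfolding matfun_def by auto
  define App where "App x a = (\<Sum>b<?n. A a b * x b)" for x a
  have ev: "App (w 0) a = \<mu> * w 0 a" if "a < ?n" for a
    unfolding App_def ev[OF that, symmetric] using that
    by (intro sum.cong refl) (simp add: matfun_def)
  have selfadj: "cip ?n x (App y) = cip ?n (App x) y" for x y
  proof -
    have "cip ?n x (App y) = (\<Sum>a<?n. \<Sum>b<?n. cnj (x a) * A a b * y b)"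
      unfolding cip_def App_def sum_distrib_left by (simp only: mult.assoc)
    also have "\<dots> = (\<Sum>b<?n. \<Sum>a<?n. cnj (A b a) * cnj (x a) * y b)"
      by (subst sum.swap) (intro sum.cong refl, simp add: Suc.prems)
    also have "\<dots> = cip ?n (App x) y"
      unfolding cip_def App_def cnj_sum sum_distrib_right complex_cnj_mult ..
    finally show ?thesis .
  qed
  \<comment> \<open>The compression to the complement of \<open>w 0\<close>, in the basis
    \<open>w (Suc i)\<close>; \<open>g\<close> below lifts its eigenvectors.\<close>
  define A' where "A' i j = cip ?n (w (Suc i)) (App (w (Suc j)))" for i j
  have "cnj (A' a b) = A' b a" for a b
    unfolding A'_def by (simp only: cip_commute selfadj)
  then have "\<exists>f t. orthonormal r f \<and> (\<forall>p<r. \<forall>a<r. (\<Sum>b<r. A' a b * f p b) = t p * f p a)"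
    by (rule Suc.IH)
  then obtain f t where f: "orthonormal r f"
    and ft: "\<forall>p<r. \<forall>a<r. (\<Sum>b<r. A' a b * f p b) = t p * f p a" by (elim exE conjE)
  define g where "g p a = (\<Sum>i<r. f p i * w (Suc i) a)" for p a
  define e where "e p = (case p of 0 \<Rightarrow> w 0 | Suc q \<Rightarrow> g q)" for p
  define s where "s p = (case p of 0 \<Rightarrow> \<mu> | Suc q \<Rightarrow> t q)" for p
  have wg: "cip ?n (w (Suc i)) (g q) = f q i" if "i < r" for i q
  proof -
    have "cip ?n (w (Suc i)) (g q) = (\<Sum>j<r. f q j * (if i = j then 1 else 0))"
      unfolding g_def cip_sum_right using that
      by (intro sum.cong refl) (simp add: orthonormalD[OF w])
    then show ?thesis using sum_delta_mult(4)[OF that] by metis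
  qed
  have w0g: "cip ?n (w 0) (g q) = 0" for q
    unfolding g_def cip_sum_right by (simp add: orthonormalD[OF w])
  have gw0: "cip ?n (g q) (w 0) = 0" for q
    using arg_cong[OF w0g[of q], of cnj] by (simp add: cip_commute)
  have gg: "cip ?n (g p) (g q) = (if p = q then 1 else 0)" if "p < r" "q < r" for p q
  proof -
    have "cip ?n (g p) (g q) = cip r (f p) (f q)"
      unfolding g_def[of p] cip_sum_left by (simp add: wg cip_def[of r])
    then show ?thesis using orthonormalD[OF f that] by simp
  qed
  have "orthonormal ?n e"
    unfolding orthonormal_def e_def
    using gg w0g gw0 orthonormalD[OF w, of 0 0] by (auto split: nat.split)
  moreover have "App (e p) a = s p * e p a" if p: "p < ?n" and a: "a < ?n" for p a
  proof (cases p)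
    case 0
    then show ?thesis using ev[OF a] by (simp add: e_def s_def)
  next
    case (Suc q)
    with p have q: "q < r" by simp
    \<comment> \<open>Invariance of the complement: self-adjointness moves the map onto the
      eigenvector \<open>w 0\<close>, which is orthogonal to \<open>g q\<close>.\<close>
    have c0: "cip ?n (w 0) (App (g q)) = 0"
    proof -
      have "cip ?n (App (w 0)) (g q) = cip ?n (\<lambda>a. \<mu> * w 0 a) (g q)"
        by (rule cip_cong) (use ev in auto)
      also have "\<dots> = cnj \<mu> * cip ?n (w 0) (g q)"
        by (simp add: cip_def sum_distrib_left mult_ac distrib_left)
      finally show ?thesis by (simp add: selfadj w0g)
    qed
    have ci: "cip ?n (w (Suc i)) (App (g q)) = t q * f q i" if i: "i < r" for i
    proof -
      have "App (g q) a = (\<Sum>j<r. f q j * App (w (Suc j)) a)" for a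
        unfolding App_def g_def sum_distrib_left
        by (subst sum.swap) (simp only: mult_ac)
      then have "App (g q) = (\<lambda>a. \<Sum>j<r. f q j * App (w (Suc j)) a)" by blast
      then have "cip ?n (w (Suc i)) (App (g q)) = (\<Sum>j<r. A' i j * f q j)"
        by (simp only: cip_sum_right A'_def mult.commute)
      then show ?thesis using ft q i by simp
    qed
    have "App (g q) a = (\<Sum>p<?n. cip ?n (w p) (App (g q)) * w p a)"
      by (rule orthonormal_expand[OF w a])
    also have "\<dots> = (\<Sum>i<r. cip ?n (w (Suc i)) (App (g q)) * w (Suc i) a)"
      by (subst sum.lessThan_Suc_shift) (simp add: c0)
    also have "\<dots> = t q * g q a"
      by (simp add: ci g_def sum_distrib_left mult_ac)
    finally show ?thesis using Suc by (simp add: e_def s_def)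
  qed
  ultimately show ?case unfolding App_def by blast
qed

text \<open>Completeness of the eigenbasis turns the eigenvector equations into a sum of rank one
  matrices. The roots are kept as a multiset because singular values are counted with
  multiplicity.\<close>

theorem hermitian_spectral:
  assumes A: "A \<in> carrier_mat n n"
    and herm: "\<forall>a<n. \<forall>b<n. cnj (A $$ (a, b)) = A $$ (b, a)"
  shows "\<exists>e t. orthonormal n e \<and>
    (\<forall>p<n. \<forall>a<n. (\<Sum>b<n. A $$ (a, b) * e p b) = t p * e p a) \<and>
    (\<forall>a<n. \<forall>b<n. A $$ (a, b) = (\<Sum>p<n. t p * e p a * cnj (e p b))) \<and>
    proots (char_poly A) = mset (map t [0..<n])"
proof -
  obtain e t where e: "orthonormal n e"
    and ev: "\<And>p a. p < n \<Longrightarrow> a < n \<Longrightarrow> (\<Sum>b<n. A $$ (a, b) * e p b) = t p * e p a"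
    using hermitian_eigenbasis[of n "\<lambda>a b. A $$ (a, b)"] herm by blast
  have dec: "A $$ (a, b) = (\<Sum>p<n. t p * e p a * cnj (e p b))" if a: "a < n" and b: "b < n" for a b
  proof -
    have "A $$ (a, b) = (\<Sum>c<n. A $$ (a, c) * (if c = b then 1 else 0))"
      using sum_delta_mult(3)[OF b] by metis
    also have "\<dots> = (\<Sum>c<n. A $$ (a, c) * (\<Sum>p<n. e p c * cnj (e p b)))"
      by (intro sum.cong refl) (use orthonormal_complete[OF e _ b] in simp)
    also have "\<dots> = (\<Sum>p<n. (\<Sum>c<n. A $$ (a, c) * e p c) * cnj (e p b))"
      unfolding sum_distrib_left sum_distrib_right by (subst sum.swap) (simp only: mult_ac)
    also have "\<dots> = (\<Sum>p<n. t p * e p a * cnj (e p b))"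
      by (intro sum.cong refl) (simp add: ev a)
    finally show ?thesis .
  qed
  define P where "P = matfun n (\<lambda>a p. e p a)"
  define Q where "Q = matfun n (\<lambda>p a. cnj (e p a))"
  define D where "D = matfun n (\<lambda>p q. if p = q then t p else 0)"
  have car: "P \<in> carrier_mat n n" "Q \<in> carrier_mat n n" "D \<in> carrier_mat n n"
    by (auto simp: P_def Q_def D_def matfun_def)
  have PD: "(P * D) $$ (a, p) = t p * e p a" if "a < n" "p < n" for a p
  proof -
    have "(P * D) $$ (a, p) = (\<Sum>q<n. e q a * (if q = p then t q else 0))"
      using that by (simp add: P_def D_def matfun_def scalar_prod_def atLeast0LessThan)
    also have "\<dots> = (\<Sum>q<n. if q = p then e q a * t q else 0)"
      by (intro sum.cong refl) simp
    finally show ?thesis using that by (simp add: mult.commute)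
  qed
  have "A = P * D * Q"
  proof (rule eq_matI)
    fix a b assume "a < dim_row (P * D * Q)" "b < dim_col (P * D * Q)"
    then have ab: "a < n" "b < n" using car by auto
    have "(P * D * Q) $$ (a, b) = (\<Sum>p<n. (P * D) $$ (a, p) * cnj (e p b))"
      using ab car by (simp add: scalar_prod_def atLeast0LessThan Q_def matfun_def)
    then show "A $$ (a, b) = (P * D * Q) $$ (a, b)" using dec[OF ab] PD ab by simp
  qed (use A car in auto)
  \<comment> \<open>\<open>P\<close> and \<open>Q\<close> are mutually inverse by orthonormality, so
    the characteristic polynomial is that of the diagonal matrix \<open>D\<close>.\<close>
  then have "similar_mat A D"
    unfolding similar_mat_def using orthonormal_inverse[OF e] A car
    by (intro exI[of _ P] exI[of _ Q] similar_mat_witI[of _ _ n]) (auto simp: P_def Q_def)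
  then have "char_poly A = char_poly D" by (rule char_poly_similar)
  also have "\<dots> = (\<Prod>a\<leftarrow>diag_mat D. [:- a, 1:])"
    by (rule char_poly_upper_triangular[OF car(3)]) (auto simp: D_def matfun_def)
  also have "diag_mat D = map t [0..<n]"
    by (auto simp: diag_mat_def D_def matfun_def)
  finally have cp: "char_poly A = (\<Prod>a\<leftarrow>map t [0..<n]. [:- a, 1:])" .
  have "proots (\<Prod>a\<leftarrow>xs. [:- a, 1:]) = mset xs" for xs :: "complex list"
  proof (induction xs)
    case (Cons x xs)
    have "(\<Prod>a\<leftarrow>xs. [:- a, 1:]) \<noteq> 0" by (auto simp: prod_list_zero_iff)
    then show ?case using Cons by (simp add: proots_mult del: mult_pCons_left)
  qed simp
  then have "proots (char_poly A) = mset (map t [0..<n])" unfolding cp by blast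
  with e ev dec show ?thesis by (intro exI[of _ e] exI[of _ t] conjI allI impI)
qed

section \<open>Positive semidefinite block matrices\<close>

text \<open>Entry \<open>(a, b)\<close> of block \<open>(i, j)\<close> is \<open>K i j a b\<close>;
  with block and entry indices apart, the partial transpose is just the swap of \<open>i\<close> and
  \<open>j\<close>.\<close>

definition block_form :: "nat \<Rightarrow> nat \<Rightarrow> (nat \<Rightarrow> nat \<Rightarrow> nat \<Rightarrow> nat \<Rightarrow> complex) \<Rightarrow> (nat \<Rightarrow> nat \<Rightarrow> complex) \<Rightarrow> complex" where
  "block_form d k K x = (\<Sum>i<k. \<Sum>a<d. \<Sum>j<k. \<Sum>b<d. cnj (x i a) * K i j a b * x j b)"

lemma mat_adjoint_index:
  assumes "i < dim_col A" "j < dim_row A"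
  shows "mat_adjoint A $$ (i, j) = cnj (A $$ (j, i))"
  using assms by (simp add: mat_adjoint_def mat_of_rows_def)

lemma mat_adjoint_dim [simp]: "dim_row (mat_adjoint A) = dim_col A" "dim_col (mat_adjoint A) = dim_row A"
  by (simp_all add: mat_adjoint_def)

lemma sum_two_support:
  fixes f :: "nat \<Rightarrow> complex"
  assumes "p < n" "q < n" "p \<noteq> q" "\<And>i. i < n \<Longrightarrow> i \<noteq> p \<Longrightarrow> i \<noteq> q \<Longrightarrow> f i = 0"
  shows "(\<Sum>i<n. f i) = f p + f q"
proof -
  have "(\<Sum>i<n. f i) = (\<Sum>i\<in>{p, q}. f i)"
    by (rule sum.mono_neutral_right) (use assms in auto)
  then show ?thesis using assms(3) by simp
qed

text \<open>Polarization: the order on complex numbers forces every value of the form to be real,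
  and it is evaluated at basis vectors and at combinations of two of them.\<close>

lemma nonneg_form_hermitian:
  fixes f :: "nat \<Rightarrow> nat \<Rightarrow> complex"
  assumes nn: "\<And>x. 0 \<le> (\<Sum>r<n. \<Sum>c<n. cnj (x r) * f r c * x c)"
    and p: "p < n" and q: "q < n"
  shows "cnj (f p q) = f q p"
proof -
  have diag: "Im (f r r) = 0" if r: "r < n" for r
  proof -
    have "(\<Sum>i<n. \<Sum>c<n. cnj (if i = r then 1 else 0) * f i c * (if c = r then 1 else 0))
        = (\<Sum>i<n. (if i = r then 1 else 0) * f i r)"
      by (intro sum.cong refl, subst sum_delta_mult(3)[OF r]) simp
    also have "\<dots> = f r r" by (rule sum_delta_mult(1)[OF r])
    finally show ?thesis using nn[of "\<lambda>i. if i = r then 1 else 0"]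
      by (simp add: less_eq_complex_def)
  qed
  show ?thesis
  proof (cases "p = q")
    case True
    then show ?thesis using diag[OF p] by (simp add: complex_eq_iff)
  next
    case False
    have form: "(\<Sum>r<n. \<Sum>c<n. cnj (x r) * f r c * x c)
        = f p p + u * f p q + cnj u * f q p + cnj u * f q q * u"
      if x: "x = (\<lambda>i. if i = p then 1 else if i = q then u else 0)" for u x
    proof -
      have "(\<Sum>r<n. \<Sum>c<n. cnj (x r) * f r c * x c)
          = (\<Sum>r<n. cnj (x r) * f r p * x p + cnj (x r) * f r q * x q)"
        by (intro sum.cong refl sum_two_support[OF p q False]) (simp add: x)
      also have "\<dots> = (cnj (x p) * f p p * x p + cnj (x p) * f p q * x q)
          + (cnj (x q) * f q p * x p + cnj (x q) * f q q * x q)"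
        by (intro sum_two_support[OF p q False]) (simp add: x)
      finally show ?thesis using False by (simp add: x mult_ac)
    qed
    have "Im (f p p + u * f p q + cnj u * f q p + cnj u * f q q * u) = 0" for u
      using nn[of "\<lambda>i. if i = p then 1 else if i = q then u else 0"]
      unfolding form[OF refl] by (simp add: less_eq_complex_def)
    \<comment> \<open>\<open>u = 1\<close> makes the imaginary parts of \<open>f p q\<close> and
      \<open>f q p\<close> opposite, and \<open>u = \<i>\<close> makes their real parts
      equal.\<close>
    from this[of 1] this[of \<i>] show ?thesis
      using diag[OF p] diag[OF q] by (simp add: complex_eq_iff)
  qed
qed

lemma mult_cnj_nonneg: "0 \<le> z * cnj z"
  by (simp add: complex_mult_cnj less_eq_complex_def)

lemma psd_iff_form:
  "psd A \<longleftrightarrow> square_mat A \<and>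
     (\<forall>x. 0 \<le> (\<Sum>r<dim_row A. \<Sum>c<dim_row A. cnj (x r) * A $$ (r, c) * x c))"
proof (cases "square_mat A")
  case sq: True
  define N where "N = dim_row A"
  have A: "A \<in> carrier_mat N N" using sq by (auto simp: N_def square_mat.simps)
  have form: "(A *\<^sub>v x) \<bullet>c x = (\<Sum>r<N. \<Sum>c<N. cnj (x $ r) * A $$ (r, c) * x $ c)"
    if "x \<in> carrier_vec N" for x
    using that A by (simp add: scalar_prod_def atLeast0LessThan sum_distrib_left mult_ac)
  have "psd A \<longleftrightarrow> mat_adjoint A = A \<and> (\<forall>x. 0 \<le> (\<Sum>r<N. \<Sum>c<N. cnj (x r) * A $$ (r, c) * x c))"
    (is "_ \<longleftrightarrow> _ \<and> ?nn")
  proof -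
    have "(\<forall>x\<in>carrier_vec N. 0 \<le> (A *\<^sub>v x) \<bullet>c x) \<longleftrightarrow> ?nn"
    proof
      assume l: "\<forall>x\<in>carrier_vec N. 0 \<le> (A *\<^sub>v x) \<bullet>c x"
      show ?nn
      proof
        fix x :: "nat \<Rightarrow> complex"
        show "0 \<le> (\<Sum>r<N. \<Sum>c<N. cnj (x r) * A $$ (r, c) * x c)"
          using l[rule_format, of "vec N x"] form[of "vec N x"] by simp
      qed
    next
      assume ?nn
      then show "\<forall>x\<in>carrier_vec N. 0 \<le> (A *\<^sub>v x) \<bullet>c x" using form by simp
    qed
    then show ?thesis using sq unfolding psd_def N_def by blast
  qed
  \<comment> \<open>Hermitian symmetry is recovered from the values of the form by
    polarization.\<close>
  moreover have "mat_adjoint A = A" if nn: ?nn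
  proof (rule eq_matI)
    fix i j assume "i < dim_row A" "j < dim_col A"
    then show "mat_adjoint A $$ (i, j) = A $$ (i, j)"
      using nonneg_form_hermitian[where n = N and f = "\<lambda>r c. A $$ (r, c)" and p = j and q = i] nn A
      by (auto simp: mat_adjoint_index)
  qed (use A in auto)
  ultimately show ?thesis using sq unfolding N_def by blast
qed (auto simp: psd_def)

lemma sum_div_mod:
  fixes f :: "nat \<Rightarrow> nat \<Rightarrow> complex"
  shows "(\<Sum>r<k * d. f (r div d) (r mod d)) = (\<Sum>i<k. \<Sum>a<d. f i a)"
proof (cases "d = 0")
  case False
  have "(\<Sum>r<k * d. f (r div d) (r mod d)) = (\<Sum>i<k. \<Sum>r=i*d..<i*d+d. f (r div d) (r mod d))"
    by (rule sum.nat_group[symmetric])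
  also have "\<dots> = (\<Sum>i<k. \<Sum>a<d. f i a)"
  proof (rule sum.cong[OF refl])
    fix i
    have "(\<Sum>r=i*d..<i*d+d. f (r div d) (r mod d)) = (\<Sum>a=0..<d. f ((a + i*d) div d) ((a + i*d) mod d))"
      using sum.shift_bounds_nat_ivl[of "\<lambda>r. f (r div d) (r mod d)" 0 "i*d" d] by (simp add: add.commute)
    also have "\<dots> = (\<Sum>a<d. f i a)"
      using False by (auto simp: atLeast0LessThan intro!: sum.cong)
    finally show "(\<Sum>r=i*d..<i*d+d. f (r div d) (r mod d)) = (\<Sum>a<d. f i a)" .
  qed
  finally show ?thesis .
qed simp

lemma psd_block_mat_iff:
  "psd (block_mat d k A) \<longleftrightarrow> (\<forall>x. 0 \<le> block_form d k (\<lambda>i j a b. A i j $$ (a, b)) x)"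
proof -
  have form: "(\<Sum>r<k * d. \<Sum>c<k * d. cnj (x (r div d) (r mod d)) * block_mat d k A $$ (r, c) * x (c div d) (c mod d))
      = block_form d k (\<lambda>i j a b. A i j $$ (a, b)) x" for x
  proof -
    have "(\<Sum>r<k * d. \<Sum>c<k * d. cnj (x (r div d) (r mod d)) * block_mat d k A $$ (r, c) * x (c div d) (c mod d))
      = (\<Sum>r<k * d. \<Sum>c<k * d. cnj (x (r div d) (r mod d)) * A (r div d) (c div d) $$ (r mod d, c mod d) * x (c div d) (c mod d))"
      by (intro sum.cong refl) (simp add: block_mat_def)
    also have "\<dots> = (\<Sum>r<k * d. \<Sum>j<k. \<Sum>b<d. cnj (x (r div d) (r mod d)) * A (r div d) j $$ (r mod d, b) * x j b)"
      by (intro sum.cong refl sum_div_mod)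
    also have "\<dots> = block_form d k (\<lambda>i j a b. A i j $$ (a, b)) x"
      unfolding block_form_def by (rule sum_div_mod)
    finally show ?thesis .
  qed
  have dim: "dim_row (block_mat d k A) = k * d" "square_mat (block_mat d k A)"
    by (simp_all add: block_mat_def square_mat.simps)
  show ?thesis
  proof
    assume "psd (block_mat d k A)"
    then have nn: "\<forall>y. 0 \<le> (\<Sum>r<k * d. \<Sum>c<k * d. cnj (y r) * block_mat d k A $$ (r, c) * y c)"
      unfolding psd_iff_form dim(1) by (rule conjunct2)
    show "\<forall>x. 0 \<le> block_form d k (\<lambda>i j a b. A i j $$ (a, b)) x"
      unfolding form[symmetric] by (intro allI nn[rule_format])
  next
    assume nn: "\<forall>x. 0 \<le> block_form d k (\<lambda>i j a b. A i j $$ (a, b)) x"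
    \<comment> \<open>Every flat vector \<open>y\<close> arises from a two-index one, because
      \<open>r = (r div d) * d + r mod d\<close>.\<close>
    have "0 \<le> (\<Sum>r<k * d. \<Sum>c<k * d. cnj (y r) * block_mat d k A $$ (r, c) * y c)" for y
      using nn[rule_format, of "\<lambda>i a. y (i * d + a)"] unfolding form[symmetric] by simp
    then show "psd (block_mat d k A)" unfolding psd_iff_form dim(1) using dim(2) by blast
  qed
qed

text \<open>The spectral decomposition of the flattened matrix, with square roots of the nonnegative
  eigenvalues absorbed into the vectors. It reduces statements about positive semidefinite blocks to
  rank one blocks.\<close>

lemma psd_blocks_gram:
  assumes "psd_blocks n k A"
  obtains v :: "nat \<Rightarrow> nat \<Rightarrow> nat \<Rightarrow> complex" where
    "\<And>i j c d. i < k \<Longrightarrow> j < k \<Longrightarrow> c < n \<Longrightarrow> d < n \<Longrightarrow>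
       A i j $$ (c, d) = (\<Sum>r<k * n. v r i c * cnj (v r j d))"
proof -
  let ?N = "k * n" and ?M = "block_mat n k A"
  have psd: "psd ?M" using assms by (simp add: psd_blocks_def)
  have M: "?M \<in> carrier_mat ?N ?N" by (simp add: block_mat_def)
  have nn: "0 \<le> (\<Sum>r<?N. \<Sum>c<?N. cnj (x r) * ?M $$ (r, c) * x c)" for x
    using psd M unfolding psd_iff_form by auto
  have "\<forall>a<?N. \<forall>b<?N. cnj (?M $$ (a, b)) = ?M $$ (b, a)"
    by (intro allI impI nonneg_form_hermitian[OF nn])
  from hermitian_spectral[OF M this] obtain e t where e: "orthonormal ?N e"
    and ev: "\<forall>p<?N. \<forall>a<?N. (\<Sum>b<?N. ?M $$ (a, b) * e p b) = t p * e p a"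
    and dec: "\<forall>a<?N. \<forall>b<?N. ?M $$ (a, b) = (\<Sum>p<?N. t p * e p a * cnj (e p b))"
    by (elim exE conjE)
  have t: "0 \<le> t p" if p: "p < ?N" for p
  proof -
    have "(\<Sum>r<?N. \<Sum>c<?N. cnj (e p r) * ?M $$ (r, c) * e p c) = (\<Sum>r<?N. cnj (e p r) * (t p * e p r))"
      by (intro sum.cong refl) (simp add: ev[rule_format, OF p, symmetric] sum_distrib_left mult.assoc)
    also have "\<dots> = t p * cip ?N (e p) (e p)" by (simp add: cip_def sum_distrib_left mult_ac)
    also have "\<dots> = t p" using orthonormalD[OF e p p] by simp
    finally show ?thesis using nn[of "e p"] by simp
  qed
  define s where "s p = complex_of_real (sqrt (Re (t p)))" for p
  have s: "t p = s p * cnj (s p)" if "p < ?N" for p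
    using t[OF that] by (simp add: s_def less_eq_complex_def complex_eq_iff flip: of_real_mult)
  show thesis
  \<comment> \<open>Flat position \<open>i * n + c\<close> is entry \<open>c\<close> of block
    \<open>i\<close>, so \<open>v r i\<close> is block \<open>i\<close> of a scaled
    eigenvector.\<close>
  proof (rule that[of "\<lambda>r i c. s r * e r (i * n + c)"])
    fix i j c d assume *: "i < k" "j < k" "c < n" "d < n"
    have bound: "i' * n + c' < ?N" if "i' < k" "c' < n" for i' c'
    proof -
      have "i' * n + c' < Suc i' * n" using that by simp
      also have "\<dots> \<le> k * n" using that by (intro mult_le_mono1) simp
      finally show ?thesis .
    qed
    have "A i j $$ (c, d) = ?M $$ (i * n + c, j * n + d)"
      using * bound by (simp add: block_mat_def)
    also have "\<dots> = (\<Sum>p<?N. t p * e p (i * n + c) * cnj (e p (j * n + d)))"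
      using * bound by (intro dec[rule_format]) auto
    also have "\<dots> = (\<Sum>p<?N. s p * e p (i * n + c) * cnj (s p * e p (j * n + d)))"
      by (intro sum.cong refl) (simp add: s mult_ac)
    finally show "A i j $$ (c, d) = (\<Sum>p<?N. s p * e p (i * n + c) * cnj (s p * e p (j * n + d)))" .
  qed
qed

text \<open>The form is the squared modulus of one linear functional of the conjugate of
  \<open>x\<close>.\<close>

lemma psd_blocks_rank_one:
  "psd_blocks n k (\<lambda>i j. mat n n (\<lambda>(c, d). v i c * cnj (v j d)))"
proof -
  have "block_form n k (\<lambda>i j a b. mat n n (\<lambda>(c, d). v i c * cnj (v j d)) $$ (a, b)) x
      = (\<Sum>i<k. \<Sum>a<n. cnj (x i a) * v i a) * cnj (\<Sum>j<k. \<Sum>b<n. cnj (x j b) * v j b)" for x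
    unfolding block_form_def sum_distrib_right unfolding cnj_sum sum_distrib_left
    by (intro sum.cong refl) (simp add: mult_ac)
  then show ?thesis unfolding psd_blocks_def psd_block_mat_iff
    by (simp only: mult_cnj_nonneg) simp
qed

section \<open>Quadratic forms of the image of \<open>Phi_plus\<close>\<close>

lemma Phi_plus_index:
  assumes B: "B \<in> carrier_mat m n" and X: "X \<in> carrier_mat n n" and ab: "a < m" "b < m"
  shows "Phi_plus \<alpha> B X $$ (a, b) = (if a = b then of_real \<alpha> * (\<Sum>c<n. X $$ (c, c)) else 0)
    + (\<Sum>c<n. \<Sum>d<n. B $$ (a, c) * X $$ (c, d) * cnj (B $$ (b, d)))"
proof -
  have "(B * X * mat_adjoint B) $$ (a, b) = (\<Sum>d<n. (\<Sum>c<n. B $$ (a, c) * X $$ (c, d)) * cnj (B $$ (b, d)))"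
    using B X ab by (simp add: scalar_prod_def atLeast0LessThan mat_adjoint_index)
  also have "\<dots> = (\<Sum>c<n. \<Sum>d<n. B $$ (a, c) * X $$ (c, d) * cnj (B $$ (b, d)))"
    unfolding sum_distrib_right by (rule sum.swap)
  finally show ?thesis
    using B X ab by (simp add: Phi_plus_def mat_trace_def)
qed

text \<open>Linearity in \<open>X\<close>, one rank one term at a time. \<open>u\<close> and
  \<open>v\<close> are separate because an off-diagonal block pairs two different vectors.\<close>

lemma Phi_plus_index_gram:
  assumes B: "B \<in> carrier_mat m n" and X: "X \<in> carrier_mat n n" and ab: "a < m" "b < m"
    and gram: "\<And>c d. c < n \<Longrightarrow> d < n \<Longrightarrow> X $$ (c, d) = (\<Sum>r\<in>R. u r c * cnj (v r d))"
  shows "Phi_plus \<alpha> B X $$ (a, b) =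
    (\<Sum>r\<in>R. (if a = b then of_real \<alpha> * (\<Sum>c<n. u r c * cnj (v r c)) else 0)
      + (\<Sum>c<n. B $$ (a, c) * u r c) * cnj (\<Sum>d<n. B $$ (b, d) * v r d))"
proof -
  have 1: "(\<Sum>c<n. X $$ (c, c)) = (\<Sum>r\<in>R. \<Sum>c<n. u r c * cnj (v r c))"
    by (subst sum.swap) (simp add: gram)
  have "(\<Sum>c<n. \<Sum>d<n. B $$ (a, c) * X $$ (c, d) * cnj (B $$ (b, d)))
      = (\<Sum>c<n. \<Sum>d<n. \<Sum>r\<in>R. B $$ (a, c) * (u r c * cnj (v r d)) * cnj (B $$ (b, d)))"
    by (intro sum.cong refl) (simp add: gram sum_distrib_left sum_distrib_right)
  also have "\<dots> = (\<Sum>r\<in>R. \<Sum>c<n. \<Sum>d<n. B $$ (a, c) * (u r c * cnj (v r d)) * cnj (B $$ (b, d)))"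
    by (simp only: sum.swap[where A = "{..<n}" and B = R])
  also have "\<dots> = (\<Sum>r\<in>R. (\<Sum>c<n. B $$ (a, c) * u r c) * cnj (\<Sum>d<n. B $$ (b, d) * v r d))"
    unfolding cnj_sum sum_product by (intro sum.cong refl) (simp add: mult_ac)
  finally show ?thesis
    unfolding Phi_plus_index[OF B X ab] 1 by (simp add: sum.distrib sum_distrib_left)
qed

lemma block_form_cong:
  "(\<And>i j a b. i < k \<Longrightarrow> j < k \<Longrightarrow> a < d \<Longrightarrow> b < d \<Longrightarrow> K i j a b = K' i j a b) \<Longrightarrow>
    block_form d k K x = block_form d k K' x"
  unfolding block_form_def by (intro sum.cong refl) simp

lemma block_form_sum:
  "block_form d k (\<lambda>i j a b. \<Sum>r\<in>R. K r i j a b) x = (\<Sum>r\<in>R. block_form d k (K r) x)"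
  unfolding block_form_def sum_distrib_left sum_distrib_right
  by (simp only: sum.swap[where A = "{..<k}" and B = R] sum.swap[where A = "{..<d}" and B = R])

lemma block_form_add:
  "block_form d k (\<lambda>i j a b. K i j a b + L i j a b) x = block_form d k K x + block_form d k L x"
  unfolding block_form_def by (simp only: distrib_left distrib_right sum.distrib)

text \<open>This handles the trace term: for fixed \<open>a\<close> and \<open>c\<close> the double
  sum over blocks factors. With mutually conjugate factors the result is \<open>\<alpha>\<close>
  times a squared Frobenius norm.\<close>

lemma block_form_diag:
  "block_form d k (\<lambda>i j a b. if a = b then \<alpha> * (\<Sum>c<n. p i c * q j c) else 0) x
    = \<alpha> * (\<Sum>a<d. \<Sum>c<n. (\<Sum>i<k. cnj (x i a) * p i c) * (\<Sum>j<k. q j c * x j a))"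
proof -
  have "block_form d k (\<lambda>i j a b. if a = b then \<alpha> * (\<Sum>c<n. p i c * q j c) else 0) x
      = (\<Sum>i<k. \<Sum>a<d. \<Sum>j<k. (\<alpha> * cnj (x i a) * (\<Sum>c<n. p i c * q j c)) * x j a)"
    unfolding block_form_def
  proof (intro sum.cong refl)
    fix i a j assume "a \<in> {..<d}"
    then have a: "a < d" by simp
    have "(\<Sum>b<d. cnj (x i a) * (if a = b then \<alpha> * (\<Sum>c<n. p i c * q j c) else 0) * x j b)
       = (\<Sum>b<d. (if a = b then 1 else 0) * (\<alpha> * cnj (x i a) * (\<Sum>c<n. p i c * q j c) * x j b))"
      by (intro sum.cong refl) simp
    also have "\<dots> = \<alpha> * cnj (x i a) * (\<Sum>c<n. p i c * q j c) * x j a"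
      by (rule sum_delta_mult(2)[OF a])
    finally show "(\<Sum>b<d. cnj (x i a) * (if a = b then \<alpha> * (\<Sum>c<n. p i c * q j c) else 0) * x j b)
      = \<alpha> * cnj (x i a) * (\<Sum>c<n. p i c * q j c) * x j a" .
  qed
  also have "\<dots> = (\<Sum>i<k. \<Sum>a<d. \<Sum>j<k. \<Sum>c<n. \<alpha> * ((cnj (x i a) * p i c) * (q j c * x j a)))"
    unfolding sum_distrib_left sum_distrib_right by (intro sum.cong refl) (simp add: mult_ac)
  also have "\<dots> = (\<Sum>a<d. \<Sum>c<n. \<Sum>i<k. \<Sum>j<k. \<alpha> * ((cnj (x i a) * p i c) * (q j c * x j a)))"
    by (simp only: sum.swap[where A = "{..<k}" and B = "{..<d}"] sum.swap[where A = "{..<k}" and B = "{..<n}"])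
  also have "\<dots> = \<alpha> * (\<Sum>a<d. \<Sum>c<n. (\<Sum>i<k. cnj (x i a) * p i c) * (\<Sum>j<k. q j c * x j a))"
    unfolding sum_product unfolding sum_distrib_left ..
  finally show ?thesis .
qed

text \<open>Without the block swap, the kernel \<open>y i a * cnj (y j b)\<close> has rank one and
  contributes a squared modulus, so \<open>\<alpha> \<ge> 0\<close> suffices.\<close>

lemma block_form_gram_nonneg:
  assumes "0 \<le> \<alpha>"
  shows "0 \<le> block_form d k (\<lambda>i j a b. (if a = b then complex_of_real \<alpha> * (\<Sum>c<n. v i c * cnj (v j c)) else 0)
    + y i a * cnj (y j b)) x"
proof -
  define Z where "Z a c = (\<Sum>i<k. cnj (x i a) * v i c)" for a c
  have Z: "(\<Sum>j<k. cnj (v j c) * x j a) = cnj (Z a c)" for a c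
    by (simp add: Z_def mult.commute)
  have "block_form d k (\<lambda>i j a b. y i a * cnj (y j b)) x
      = (\<Sum>i<k. \<Sum>a<d. cnj (x i a) * y i a) * cnj (\<Sum>j<k. \<Sum>b<d. cnj (x j b) * y j b)"
    unfolding block_form_def sum_distrib_right unfolding cnj_sum sum_distrib_left
    by (intro sum.cong refl) (simp add: mult_ac)
  moreover have "0 \<le> complex_of_real \<alpha> * (\<Sum>a<d. \<Sum>c<n. Z a c * cnj (Z a c))"
    using assms by (intro mult_nonneg_nonneg sum_nonneg mult_cnj_nonneg) (simp add: less_eq_complex_def)
  ultimately show ?thesis
    unfolding block_form_add block_form_diag Z Z_def[symmetric] by (simp only: add_nonneg_nonneg mult_cnj_nonneg)
qed

text \<open>With \<open>Z = \<Sum>\<^sub>j x\<^sub>j v\<^sub>j\<^sup>T\<close>, an \<open>m \<times> n\<close> matrix, and \<open>T = Z B\<^sup>T\<close>, both sides equal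
  \<open>\<alpha> \<parallel>Z\<parallel>\<^sup>2 + \<Sum>\<^sub>a\<^sub>b T\<^sub>b\<^sub>a cnj T\<^sub>a\<^sub>b\<close>, and \<open>z p\<close> is \<open>Z\<close> applied to the conjugate of \<open>e p\<close>.\<close>

lemma block_form_swapped:
  fixes v x B :: "nat \<Rightarrow> nat \<Rightarrow> complex" and k m n :: nat
  assumes e: "orthonormal n e"
  defines "y \<equiv> \<lambda>i a. \<Sum>c<n. B a c * v i c"
  defines "b \<equiv> \<lambda>p a. \<Sum>c<n. B a c * e p c"
  defines "z \<equiv> \<lambda>p a. \<Sum>j<k. cip n (e p) (v j) * x j a"
  shows "block_form m k (\<lambda>i j a b. (if a = b then \<alpha> * (\<Sum>c<n. v j c * cnj (v i c)) else 0)
      + y j a * cnj (y i b)) x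
    = \<alpha> * (\<Sum>p<n. cip m (z p) (z p)) + (\<Sum>p<n. \<Sum>q<n. cip m (b q) (z p) * cnj (cip m (b p) (z q)))"
proof -
  define Z where "Z a c = (\<Sum>j<k. v j c * x j a)" for a c
  define T where "T a b' = (\<Sum>j<k. y j b' * x j a)" for a b'
  have Zc: "(\<Sum>i<k. cnj (x i a) * cnj (v i c)) = cnj (Z a c)" for a c
    by (simp add: Z_def mult.commute)
  have zZ: "cip n (e p) (Z a) = z p a" for p a
  proof -
    have "cip n (e p) (Z a) = cip n (e p) (\<lambda>c. \<Sum>j<k. x j a * v j c)"
      by (simp add: Z_def[abs_def] mult.commute)
    then show ?thesis unfolding cip_sum_right z_def by (simp add: mult.commute)
  qed
  have ye: "y j a = (\<Sum>p<n. cip n (e p) (v j) * b p a)" for j a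
  proof -
    have "y j a = (\<Sum>c<n. B a c * (\<Sum>p<n. cip n (e p) (v j) * e p c))"
      unfolding y_def by (intro sum.cong refl arg_cong2[of _ _ _ _ "(*)"] orthonormal_expand[OF e]) auto
    also have "\<dots> = (\<Sum>p<n. cip n (e p) (v j) * b p a)"
      unfolding b_def sum_distrib_left by (subst sum.swap) (simp only: mult_ac)
    finally show ?thesis .
  qed
  have Tz: "T a b' = (\<Sum>p<n. z p a * b p b')" for a b'
    unfolding T_def ye z_def sum_distrib_right by (subst sum.swap) (simp only: mult_ac)
  \<comment> \<open>Parseval for row \<open>a\<close> of \<open>Z\<close>, whose coefficients in the
    basis \<open>e\<close> are the \<open>z p a\<close>.\<close>
  have "(\<Sum>c<n. cnj (Z a c) * Z a c) = (\<Sum>p<n. cnj (z p a) * z p a)" for a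
  proof -
    have "(\<Sum>c<n. cnj (Z a c) * Z a c) = cip n (Z a) (\<lambda>c. \<Sum>p<n. z p a * e p c)"
      unfolding cip_def using orthonormal_expand[OF e, of _ "Z a"] by (intro sum.cong refl) (simp add: zZ)
    also have "\<dots> = (\<Sum>p<n. z p a * cip n (Z a) (e p))" by (rule cip_sum_right)
    also have "\<dots> = (\<Sum>p<n. cnj (z p a) * z p a)"
      by (intro sum.cong refl) (simp add: zZ[symmetric] cip_commute mult.commute)
    finally show ?thesis .
  qed
  then have "(\<Sum>a<m. \<Sum>c<n. cnj (Z a c) * Z a c) = (\<Sum>p<n. cip m (z p) (z p))"
    unfolding cip_def by (subst sum.swap) simp
  \<comment> \<open>The swap attaches \<open>y j\<close> to the row entry \<open>a\<close> while
    \<open>x j\<close> keeps \<open>b'\<close>. Summing over blocks therefore pairs \<open>T\<close>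
    with its transpose, and the result need not be a squared modulus.\<close>
  moreover have "block_form m k (\<lambda>i j a b. y j a * cnj (y i b)) x
      = (\<Sum>p<n. \<Sum>q<n. cip m (b q) (z p) * cnj (cip m (b p) (z q)))"
  proof -
    have "block_form m k (\<lambda>i j a b. y j a * cnj (y i b)) x
        = (\<Sum>i<k. \<Sum>a<m. \<Sum>j<k. \<Sum>b'<m. (cnj (y i b') * cnj (x i a)) * (y j a * x j b'))"
      unfolding block_form_def by (intro sum.cong refl) (simp add: mult_ac)
    also have "\<dots> = (\<Sum>a<m. \<Sum>b'<m. \<Sum>i<k. \<Sum>j<k. (cnj (y i b') * cnj (x i a)) * (y j a * x j b'))"
      by (simp only: sum.swap[where A = "{..<k}" and B = "{..<m}"])
    also have "\<dots> = (\<Sum>a<m. \<Sum>b'<m. cnj (T a b') * T b' a)"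
      unfolding T_def cnj_sum complex_cnj_mult sum_product ..
    also have "\<dots> = (\<Sum>a<m. \<Sum>b'<m. T b' a * cnj (T a b'))"
      by (intro sum.cong refl mult.commute)
    also have "\<dots> = (\<Sum>a<m. \<Sum>b'<m. \<Sum>p<n. \<Sum>q<n. (cnj (b q b') * z p b') * (b p a * cnj (z q a)))"
      unfolding Tz cnj_sum sum_product
      by (intro sum.cong refl) (simp add: mult_ac)
    also have "\<dots> = (\<Sum>p<n. \<Sum>q<n. \<Sum>a<m. \<Sum>b'<m. (cnj (b q b') * z p b') * (b p a * cnj (z q a)))"
      by (simp only: sum.swap[where A = "{..<m}" and B = "{..<n}"])
    also have "\<dots> = (\<Sum>p<n. \<Sum>q<n. cip m (b q) (z p) * cnj (cip m (b p) (z q)))"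
      unfolding cip_def cnj_sum sum_product
      by (rule sum.cong[OF refl], rule sum.cong[OF refl], subst sum.swap) (simp add: mult_ac)
    finally show ?thesis .
  qed
  moreover have "block_form m k (\<lambda>i j a b. if a = b then \<alpha> * (\<Sum>c<n. v j c * cnj (v i c)) else 0) x
      = \<alpha> * (\<Sum>a<m. \<Sum>c<n. cnj (Z a c) * Z a c)"
  proof -
    have "(\<Sum>c<n. v j c * cnj (v i c)) = (\<Sum>c<n. cnj (v i c) * v j c)" for i j
      by (simp only: mult.commute)
    then show ?thesis by (simp only: block_form_diag Zc Z_def[symmetric])
  qed
  ultimately show ?thesis unfolding block_form_add by simp
qed

section \<open>Transposition of block matrices and copositivity\<close>

lemma block_form_transpose:
  "block_form d k (\<lambda>i j a b. K j i b a) x = block_form d k K (\<lambda>i a. cnj (x i a))"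
proof -
  have pair: "(\<Sum>i<k. \<Sum>a<d. g i a) = (\<Sum>u\<in>{..<k} \<times> {..<d}. g (fst u) (snd u))" for g :: "nat \<Rightarrow> nat \<Rightarrow> complex"
    by (simp add: sum.cartesian_product case_prod_unfold)
  have "block_form d k (\<lambda>i j a b. K j i b a) x
      = (\<Sum>i<k. \<Sum>a<d. \<Sum>j<k. \<Sum>b<d. x j b * K j i b a * cnj (x i a))"
    unfolding block_form_def by (intro sum.cong refl) (simp add: mult_ac)
  also have "\<dots> = (\<Sum>j<k. \<Sum>b<d. \<Sum>i<k. \<Sum>a<d. x j b * K j i b a * cnj (x i a))"
    unfolding pair by (rule sum.swap)
  finally show ?thesis by (simp add: block_form_def)
qed

text \<open>The form of the full transpose at \<open>x\<close> is the original form at the conjugate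
  of \<open>x\<close>.\<close>

lemma psd_blocks_transpose:
  assumes "psd_blocks d k A"
  shows "psd_blocks d k (\<lambda>i j. (A j i)\<^sup>T)"
proof -
  have car: "A i j \<in> carrier_mat d d" if "i < k" "j < k" for i j
    using assms that by (simp add: psd_blocks_def)
  have "block_form d k (\<lambda>i j a b. (A j i)\<^sup>T $$ (a, b)) x
      = block_form d k (\<lambda>i j a b. A j i $$ (b, a)) x" for x
    by (rule block_form_cong) (use car in fastforce)
  then show ?thesis
    using assms unfolding psd_blocks_def psd_block_mat_iff
      block_form_transpose[where K = "\<lambda>i j a b. A i j $$ (a, b)"] by simp
qed

text \<open>Replacing \<open>A\<close> by its full transpose cancels the transposition inside each
  block and leaves only the swap of blocks. Copositivity thus becomes the second half of the PPT
  condition.\<close>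

lemma k_copositive_iff:
  assumes "linear_mat_map n m \<Phi>"
  shows "k_copositive n m k \<Phi> \<longleftrightarrow> (\<forall>A. psd_blocks n k A \<longrightarrow> psd (block_mat m k (\<lambda>i j. \<Phi> (A j i))))"
proof -
  have "(c \<cdot>\<^sub>m X)\<^sup>T = c \<cdot>\<^sub>m X\<^sup>T" for c and X :: "complex mat"
    by (rule eq_matI) auto
  then have "linear_mat_map n m (\<Phi> \<circ> transpose_mat)"
    using assms unfolding linear_mat_map_def by (auto simp: transpose_add)
  moreover have "(\<forall>A. psd_blocks n k A \<longrightarrow> psd (block_mat m k (\<lambda>i j. (\<Phi> \<circ> transpose_mat) (A i j)))) \<longleftrightarrow>
      (\<forall>A. psd_blocks n k A \<longrightarrow> psd (block_mat m k (\<lambda>i j. \<Phi> (A j i))))"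
  proof (intro iffI allI impI)
    fix A assume "\<forall>A. psd_blocks n k A \<longrightarrow> psd (block_mat m k (\<lambda>i j. (\<Phi> \<circ> transpose_mat) (A i j)))"
      and A: "psd_blocks n k A"
    from this(1)[rule_format, OF psd_blocks_transpose[OF A]]
    show "psd (block_mat m k (\<lambda>i j. \<Phi> (A j i)))" by simp
  next
    fix A assume "\<forall>A. psd_blocks n k A \<longrightarrow> psd (block_mat m k (\<lambda>i j. \<Phi> (A j i)))"
      and A: "psd_blocks n k A"
    from this(1)[rule_format, OF psd_blocks_transpose[OF A]]
    show "psd (block_mat m k (\<lambda>i j. (\<Phi> \<circ> transpose_mat) (A i j)))" by simp
  qed
  ultimately show ?thesis using assms unfolding k_copositive_def k_positive_def by blast
qed

text \<open>For every \<open>k\<close> the Gram decomposition reduces the claim to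
  \<open>block_form_gram_nonneg\<close>. Hence the first half of the PPT condition only asks for
  \<open>\<alpha> \<ge> 0\<close>.\<close>

lemma Phi_plus_k_positive:
  assumes B: "B \<in> carrier_mat m n" and \<alpha>: "0 \<le> \<alpha>" and A: "psd_blocks n k A"
  shows "psd (block_mat m k (\<lambda>i j. Phi_plus \<alpha> B (A i j)))"
proof -
  obtain v :: "nat \<Rightarrow> nat \<Rightarrow> nat \<Rightarrow> complex" where v: "\<And>i j c d. i < k \<Longrightarrow> j < k \<Longrightarrow> c < n \<Longrightarrow> d < n \<Longrightarrow>
       A i j $$ (c, d) = (\<Sum>r<k * n. v r i c * cnj (v r j d))"
    using psd_blocks_gram[OF A] by blast
  have car: "A i j \<in> carrier_mat n n" if "i < k" "j < k" for i j
    using A that by (simp add: psd_blocks_def)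
  show ?thesis unfolding psd_block_mat_iff
  proof
    fix x
    have "block_form m k (\<lambda>i j a b. Phi_plus \<alpha> B (A i j) $$ (a, b)) x
      = block_form m k (\<lambda>i j a b. \<Sum>r<k * n. (if a = b then of_real \<alpha> * (\<Sum>c<n. v r i c * cnj (v r j c)) else 0)
      + (\<Sum>c<n. B $$ (a, c) * v r i c) * cnj (\<Sum>d<n. B $$ (b, d) * v r j d)) x"
      by (intro block_form_cong Phi_plus_index_gram[OF B] car v)
    also have "0 \<le> \<dots>" unfolding block_form_sum
      by (intro sum_nonneg block_form_gram_nonneg[OF \<alpha>])
    finally show "0 \<le> block_form m k (\<lambda>i j a b. Phi_plus \<alpha> B (A i j) $$ (a, b)) x" .
  qed
qed

section \<open>Singular values\<close>

lemma cip_scale_right: "cip m x (\<lambda>a. c * y a) = c * cip m x y"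
  by (simp add: cip_def sum_distrib_left mult_ac)

lemma cip_scale_left: "cip m (\<lambda>a. c * y a) x = cnj c * cip m y x"
  by (simp add: cip_def sum_distrib_left mult_ac)

text \<open>\<open>P\<close> is the projection of \<open>x\<close> onto the span of the
  \<open>b q\<close>, and the squared norm of \<open>x - P\<close> is the difference of the two
  sides.\<close>

lemma bessel:
  fixes b :: "nat \<Rightarrow> nat \<Rightarrow> complex" and s :: "nat \<Rightarrow> real"
  assumes orth: "\<forall>p<n. \<forall>q<n. cip m (b p) (b q) = (if p = q then of_real ((s p)\<^sup>2) else 0)"
  shows "(\<Sum>q<n. (cmod (cip m (b q) x))\<^sup>2 / (s q)\<^sup>2) \<le> (\<Sum>a<m. (cmod (x a))\<^sup>2)"
proof -
  let ?t = "\<lambda>q. cip m (b q) x"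
  \<comment> \<open>If \<open>s q = 0\<close>, division by zero gives coefficient 0, so vanishing
    \<open>b q\<close> drop out.\<close>
  define c where "c q = ?t q / of_real ((s q)\<^sup>2)" for q
  define P where "P a = (\<Sum>q<n. c q * b q a)" for a
  define S where "S = (\<Sum>q<n. (cmod (?t q))\<^sup>2 / (s q)\<^sup>2)"
  have bP: "cip m (b q) P = c q * of_real ((s q)\<^sup>2)" if q: "q < n" for q
  proof -
    have "cip m (b q) P = (\<Sum>p<n. (c p * of_real ((s q)\<^sup>2)) * (if q = p then 1 else 0))"
      unfolding P_def cip_sum_right using orth q by (intro sum.cong refl) simp
    then show ?thesis using sum_delta_mult(4)[OF q] by simp
  qed
  have PP: "cip m P P = of_real S"
  proof -
    have "cip m P P = (\<Sum>q<n. cnj (c q) * (c q * of_real ((s q)\<^sup>2)))"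
      unfolding P_def[abs_def] cip_sum_left unfolding P_def[abs_def, symmetric] using bP by simp
    also have "\<dots> = of_real S" unfolding S_def of_real_sum
    proof (intro sum.cong refl)
      fix q
      show "cnj (c q) * (c q * of_real ((s q)\<^sup>2)) = of_real ((cmod (?t q))\<^sup>2 / (s q)\<^sup>2)"
        using complex_norm_square[of "?t q"]
        by (cases "s q = 0") (simp_all add: c_def power2_eq_square field_simps)
    qed
    finally show ?thesis .
  qed
  have xP: "cip m x P = of_real S"
    unfolding P_def cip_sum_right S_def of_real_sum
  proof (intro sum.cong refl)
    fix q
    show "c q * cip m x (b q) = of_real ((cmod (?t q))\<^sup>2 / (s q)\<^sup>2)"
      using complex_norm_square[of "?t q"] by (simp add: c_def cip_commute)
  qed
  have Px: "cip m P x = of_real S" using arg_cong[OF xP, of cnj] by (simp add: cip_commute)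
  have "cip m (\<lambda>a. x a - P a) (\<lambda>a. x a - P a) = cip m x x - cip m x P - cip m P x + cip m P P"
    unfolding cip_def by (simp add: algebra_simps sum.distrib sum_subtractf)
  also have "\<dots> = of_real ((\<Sum>a<m. (cmod (x a))\<^sup>2) - S)"
    unfolding xP Px PP by (simp add: cip_self)
  finally have "(\<Sum>a<m. (cmod (x a - P a))\<^sup>2) = (\<Sum>a<m. (cmod (x a))\<^sup>2) - S"
    unfolding cip_self of_real_eq_iff .
  moreover have "0 \<le> (\<Sum>a<m. (cmod (x a - P a))\<^sup>2)" by (simp add: sum_nonneg)
  ultimately show ?thesis unfolding S_def by simp
qed

text \<open>With \<open>u = cmod (t p q) / s q\<close> and \<open>v = cmod (t q p) / s p\<close>, a
  pair of distinct indices contributes at least \<open>\<alpha> * (u - v)\<^sup>2\<close>.\<close>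

lemma pairing_nonneg:
  fixes t :: "nat \<Rightarrow> nat \<Rightarrow> complex" and s :: "nat \<Rightarrow> real"
  assumes \<alpha>: "0 \<le> \<alpha>" and s: "\<forall>p<n. 0 \<le> s p"
    and le: "\<forall>p<n. \<forall>q<n. p \<noteq> q \<longrightarrow> s p * s q \<le> \<alpha>"
    and t0: "\<forall>p<n. \<forall>q<n. s q = 0 \<longrightarrow> t p q = 0"
  shows "0 \<le> \<alpha> * (\<Sum>p<n. \<Sum>q<n. (cmod (t p q))\<^sup>2 / (s q)\<^sup>2) + Re (\<Sum>p<n. \<Sum>q<n. t p q * cnj (t q p))"
proof -
  define f where "f p q = \<alpha> * ((cmod (t p q))\<^sup>2 / (s q)\<^sup>2) + Re (t p q * cnj (t q p))" for p q
  have "0 \<le> f p q + f q p" if p: "p < n" and q: "q < n" for p q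
  proof (cases "p = q")
    \<comment> \<open>On the diagonal the pairing term is a squared modulus, so only distinct
      indices constrain \<open>\<alpha>\<close>.\<close>
    case True
    then show ?thesis using \<alpha> by (simp add: f_def)
  next
    case False
    define u where "u = cmod (t p q) / s q"
    define v where "v = cmod (t q p) / s p"
    \<comment> \<open>By \<open>t0\<close> these equations survive a vanishing singular value, where
      the quotient is 0.\<close>
    have uv: "cmod (t p q) = u * s q" "cmod (t q p) = v * s p"
      using t0 p q by (auto simp: u_def v_def)
    have nn: "0 \<le> u" "0 \<le> v" using s p q by (auto simp: u_def v_def)
    have re: "\<bar>Re (t p q * cnj (t q p))\<bar> \<le> (u * v) * (s p * s q)"
      using abs_Re_le_cmod[of "t p q * cnj (t q p)"] by (simp add: norm_mult uv mult_ac)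
    have re': "Re (t q p * cnj (t p q)) = Re (t p q * cnj (t q p))" by (simp add: mult.commute)
    have "(u * v) * (s p * s q) \<le> (u * v) * \<alpha>"
      using le p q False nn by (intro mult_left_mono) auto
    moreover have "2 * (u * v) * \<alpha> \<le> (u\<^sup>2 + v\<^sup>2) * \<alpha>"
      using \<alpha> sum_squares_bound[of u v] by (intro mult_right_mono) (simp_all add: mult.assoc)
    ultimately have "0 \<le> \<alpha> * u\<^sup>2 + \<alpha> * v\<^sup>2 + 2 * Re (t p q * cnj (t q p))"
      using re by (simp add: algebra_simps)
    then show ?thesis by (simp add: f_def re' u_def v_def power_divide)
  qed
  then have "0 \<le> (\<Sum>p<n. \<Sum>q<n. f p q + f q p)" by (intro sum_nonneg) auto
  also have "\<dots> = 2 * (\<Sum>p<n. \<Sum>q<n. f p q)"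
    using sum.swap[of "\<lambda>p q. f q p" "{..<n}" "{..<n}"] by (simp add: sum.distrib)
  finally have "0 \<le> (\<Sum>p<n. \<Sum>q<n. f p q)" by simp
  then show ?thesis unfolding f_def sum.distrib sum_distrib_left[symmetric] Re_sum[symmetric] .
qed

text \<open>The image of \<open>e p\<close> under \<open>B\<close>: for an eigenbasis of
  \<open>mat_adjoint B * B\<close>, a left singular vector without normalization, possibly
  zero.\<close>

definition left_singular :: "complex mat \<Rightarrow> (nat \<Rightarrow> nat \<Rightarrow> complex) \<Rightarrow> nat \<Rightarrow> nat \<Rightarrow> complex" where
  "left_singular B e p a = (\<Sum>c<dim_col B. B $$ (a, c) * e p c)"

text \<open>Moving \<open>B\<close> across the inner product turns the Gram matrix of the images
  into that of \<open>mat_adjoint B * B\<close> in its eigenbasis. Its eigenvalues are then squared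
  norms; the \<open>s p\<close> come in no particular order.\<close>

lemma singular_basis_exists:
  assumes B: "B \<in> carrier_mat m n"
  shows "\<exists>e s. orthonormal n e \<and> (\<forall>p<n. 0 \<le> s p) \<and>
    (\<forall>p<n. \<forall>q<n. cip m (left_singular B e p) (left_singular B e q) = (if p = q then of_real ((s p)\<^sup>2) else 0)) \<and>
    singular_values B = take (min m n) (rev (sort (map s [0..<n])))"
proof -
  define M where "M = mat_adjoint B * B"
  have M: "M \<in> carrier_mat n n" using B by (auto simp: M_def)
  have Mi: "M $$ (c, d) = (\<Sum>a<m. cnj (B $$ (a, c)) * B $$ (a, d))" if "c < n" "d < n" for c d
    using B that by (simp add: M_def scalar_prod_def atLeast0LessThan mat_adjoint_index)
  have "\<forall>a<n. \<forall>b<n. cnj (M $$ (a, b)) = M $$ (b, a)" by (simp add: Mi mult.commute)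
  from hermitian_spectral[OF M this] obtain e t where e: "orthonormal n e"
    and ev: "\<forall>p<n. \<forall>a<n. (\<Sum>b<n. M $$ (a, b) * e p b) = t p * e p a"
    and cp: "proots (char_poly M) = mset (map t [0..<n])" by (elim exE conjE)
  have ip: "cip m (left_singular B e p) (left_singular B e q) = (if p = q then t p else 0)"
    if p: "p < n" and q: "q < n" for p q
  proof -
    have "cip m (left_singular B e p) (left_singular B e q)
        = (\<Sum>a<m. \<Sum>c<n. \<Sum>d<n. cnj (e p c) * (cnj (B $$ (a, c)) * B $$ (a, d)) * e q d)"
      using B unfolding cip_def left_singular_def cnj_sum sum_product by (simp add: mult_ac)
    also have "\<dots> = (\<Sum>c<n. \<Sum>d<n. \<Sum>a<m. cnj (e p c) * (cnj (B $$ (a, c)) * B $$ (a, d)) * e q d)"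
      by (simp only: sum.swap[where A = "{..<m}" and B = "{..<n}"])
    also have "\<dots> = (\<Sum>c<n. cnj (e p c) * (\<Sum>d<n. M $$ (c, d) * e q d))"
      by (simp add: Mi sum_distrib_left sum_distrib_right mult_ac)
    also have "\<dots> = (\<Sum>c<n. cnj (e p c) * (t q * e q c))"
      by (intro sum.cong refl) (use ev q in simp)
    also have "\<dots> = t q * cip n (e p) (e q)" by (simp add: cip_def sum_distrib_left mult_ac)
    finally show ?thesis using orthonormalD[OF e p q] by simp
  qed
  define s where "s p = sqrt (Re (t p))" for p
  have t: "t p = of_real ((s p)\<^sup>2)" "0 \<le> s p" if p: "p < n" for p
  proof -
    define r where "r = (\<Sum>a<m. (cmod (left_singular B e p a))\<^sup>2)"
    have "t p = of_real r" using ip[OF p p] by (simp add: cip_self r_def)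
    moreover have "0 \<le> r" by (simp add: r_def sum_nonneg)
    ultimately show "t p = of_real ((s p)\<^sup>2)" "0 \<le> s p" by (simp_all add: s_def)
  qed
  have "image_mset (\<lambda>z. sqrt (Re z)) (mset (map t [0..<n])) = mset (map s [0..<n])"
    by (simp add: s_def[abs_def] multiset.map_comp o_def)
  then have "singular_values B = take (min m n) (rev (sort (map s [0..<n])))"
    using B unfolding singular_values_def M_def[symmetric] cp by (simp only: sorted_list_of_multiset_mset carrier_matD)
  then show ?thesis using e ip t by (intro exI[of _ e] exI[of _ s]) auto
qed

text \<open>Sorting is a permutation of indices, so positions 0 and 1 come from distinct indices
  even when their values coincide.\<close>

lemma largest_two_product:
  fixes s :: "nat \<Rightarrow> real"
  assumes n: "2 \<le> n" and s: "\<forall>p<n. 0 \<le> s p"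
  defines "ys \<equiv> rev (sort (map s [0..<n]))"
  shows "\<exists>p<n. \<exists>q<n. p \<noteq> q \<and> s p * s q = ys ! 0 * ys ! 1"
    and "\<forall>p<n. \<forall>q<n. p \<noteq> q \<longrightarrow> s p * s q \<le> ys ! 0 * ys ! 1"
proof -
  let ?xs = "map s [0..<n]"
  have "mset ys = mset ?xs" by (simp add: ys_def)
  then obtain \<pi> where \<pi>: "\<pi> permutes {..<length ?xs}" and perm: "permute_list \<pi> ?xs = ys"
    by (rule mset_eq_permutation)
  from \<pi> have \<pi>: "\<pi> permutes {..<n}" by simp
  have im: "\<pi> i < n" if "i < n" for i using permutes_in_image[OF \<pi>, of i] that by simp
  have ys: "ys ! i = s (\<pi> i)" if "i < n" for i
    using that im unfolding perm[symmetric] by (simp add: permute_list_def)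
  have len: "length ys = n" by (simp add: ys_def)
  have mono: "ys ! j \<le> ys ! i" if "i \<le> j" "j < n" for i j
    using sorted_rev_nth_mono[of ys i j] that len by (simp add: ys_def)
  have nn: "0 \<le> ys ! i" if "i < n" for i using s ys im that by simp
  have "\<pi> 0 \<noteq> \<pi> 1" using permutes_inj[OF \<pi>] by (simp add: inj_eq)
  moreover have "\<pi> 0 < n" "\<pi> 1 < n" "s (\<pi> 0) * s (\<pi> 1) = ys ! 0 * ys ! 1"
    using n im ys by auto
  ultimately show "\<exists>p<n. \<exists>q<n. p \<noteq> q \<and> s p * s q = ys ! 0 * ys ! 1" by blast
  \<comment> \<open>\<open>i < j\<close> forces \<open>1 \<le> j\<close>, so the second factor
    compares with position 1; nonnegativity allows multiplying the two bounds.\<close>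
  have ordered: "ys ! i * ys ! j \<le> ys ! 0 * ys ! 1" if "i < j" "j < n" for i j
    using that n by (intro mult_mono mono nn) auto
  have "s p * s q \<le> ys ! 0 * ys ! 1" if pq: "p < n" "q < n" "p \<noteq> q" for p q
  proof -
    obtain i j where ij: "p = \<pi> i" "q = \<pi> j" using permutes_surj[OF \<pi>] by (metis surjD)
    have "i < n" "j < n" using pq ij permutes_in_image[OF \<pi>, of i] permutes_in_image[OF \<pi>, of j] by auto
    then show ?thesis
      using ordered[of i j] ordered[of j i] pq ij ys by (cases i j rule: linorder_cases) (auto simp: mult.commute)
  qed
  then show "\<forall>p<n. \<forall>q<n. p \<noteq> q \<longrightarrow> s p * s q \<le> ys ! 0 * ys ! 1" by blast
qed

text \<open>A nonzero two by two minor would make columns \<open>c\<close> and \<open>d\<close>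
  distinct and linearly independent, forcing rank at least two.\<close>

lemma rank_le_1_minor:
  fixes B :: "complex mat"
  assumes B: "B \<in> carrier_mat m n" and rank: "vec_space.rank m B \<le> 1"
    and ix: "a < m" "a' < m" "c < n" "d < n"
  shows "B $$ (a, c) * B $$ (a', d) = B $$ (a', c) * B $$ (a, d)"
proof (rule ccontr)
  assume ne: "B $$ (a, c) * B $$ (a', d) \<noteq> B $$ (a', c) * B $$ (a, d)"
  interpret vec_space "TYPE(complex)" m .
  define A where "A = mat_of_cols m [col B c, col B d]"
  have A: "A \<in> carrier_mat m 2" using mat_of_cols_carrier(1)[of m "[col B c, col B d]"] by (simp add: A_def numeral_2_eq_2)
  have cols: "cols A = [col B c, col B d]"
    unfolding A_def by (rule cols_mat_of_cols) (use B ix in auto)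
  have cd: "col B c \<noteq> col B d"
  proof
    assume "col B c = col B d"
    from arg_cong[OF this, of "\<lambda>v. v $ a"] arg_cong[OF this, of "\<lambda>v. v $ a'"] ne B ix
    show False by (simp add: mult.commute)
  qed
  have "lin_indpt (set (cols A))"
  proof
    assume "lin_dep (set (cols A))"
    then obtain v where v: "v \<in> carrier_vec 2" "v \<noteq> 0\<^sub>v 2" and Av: "A *\<^sub>v v = 0\<^sub>v m"
      using lin_depE[OF A] cols cd by auto
    have eq: "B $$ (i, c) * v $ 0 + B $$ (i, d) * v $ 1 = 0" if i: "i < m" for i
    proof -
      have "(A *\<^sub>v v) $ i = A $$ (i, 0) * v $ 0 + A $$ (i, 1) * v $ 1"
        using A v i by (simp add: scalar_prod_def numeral_2_eq_2)
      moreover have "A $$ (i, 0) = B $$ (i, c)" "A $$ (i, 1) = B $$ (i, d)"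
        using i ix B by (simp_all add: A_def mat_of_cols_def)
      ultimately show ?thesis using Av i by simp
    qed
    \<comment> \<open>Cramer's rule on rows \<open>a\<close> and \<open>a'\<close>: each coefficient
      of a dependence is annihilated by the nonzero minor.\<close>
    let ?D = "B $$ (a, c) * B $$ (a', d) - B $$ (a', c) * B $$ (a, d)"
    have "?D * v $ 0 = B $$ (a', d) * (B $$ (a, c) * v $ 0 + B $$ (a, d) * v $ 1)
        - B $$ (a, d) * (B $$ (a', c) * v $ 0 + B $$ (a', d) * v $ 1)" by (simp add: algebra_simps)
    moreover have "?D * v $ 1 = B $$ (a, c) * (B $$ (a', c) * v $ 0 + B $$ (a', d) * v $ 1)
        - B $$ (a', c) * (B $$ (a, c) * v $ 0 + B $$ (a, d) * v $ 1)" by (simp add: algebra_simps)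
    ultimately have "?D * v $ 0 = 0" "?D * v $ 1 = 0"
      by (simp_all only: eq[OF ix(1)] eq[OF ix(2)] mult_zero_right diff_zero)
    then have "v $ 0 = 0" "v $ 1 = 0" using ne by auto
    then have "v = 0\<^sub>v 2" using v(1) by (intro eq_vecI) (auto simp: less_2_cases_iff)
    with v(2) show False by simp
  qed
  then have "lin_indpt {col B c, col B d}" unfolding cols by simp
  moreover have "{col B c, col B d} \<subseteq> set (cols B)" using B ix by (auto simp: cols_def)
  ultimately have "card {col B c, col B d} \<le> rank B" by (intro rank_ge_card_indpt[OF B])
  with cd rank show False by simp
qed

text \<open>Vanishing minors make the two images parallel, so Cauchy-Schwarz holds with equality:
  the product of their squared norms equals the squared modulus of their inner product, which is
  zero.\<close>

lemma rank_le_1_singular: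
  assumes B: "B \<in> carrier_mat m n" and rank: "vec_space.rank m B \<le> 1"
    and orth: "cip m (left_singular B e p) (left_singular B e q) = 0"
    and p: "cip m (left_singular B e p) (left_singular B e p) = of_real ((s p)\<^sup>2)"
    and q: "cip m (left_singular B e q) (left_singular B e q) = of_real ((s q)\<^sup>2)"
  shows "s p * s q = 0"
proof -
  let ?b = "left_singular B e"
  have minor: "?b p a * ?b q a' = ?b p a' * ?b q a" if "a < m" "a' < m" for a a'
    using B unfolding left_singular_def sum_product
    by (intro sum.cong refl) (use rank_le_1_minor[OF B rank that] in \<open>simp add: mult_ac\<close>)
  have "cip m (?b p) (?b p) * cip m (?b q) (?b q) = (\<Sum>a<m. \<Sum>a'<m. cnj (?b p a) * cnj (?b q a') * (?b p a * ?b q a'))"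
    unfolding cip_def sum_product by (simp add: mult_ac)
  also have "\<dots> = (\<Sum>a<m. \<Sum>a'<m. cnj (?b p a) * cnj (?b q a') * (?b p a' * ?b q a))"
    by (intro sum.cong refl arg_cong2[of _ _ _ _ "(*)"] minor) auto
  also have "\<dots> = cip m (?b p) (?b q) * cip m (?b q) (?b p)"
    unfolding cip_def sum_product by (simp add: mult_ac)
  finally have "complex_of_real ((s p)\<^sup>2) * of_real ((s q)\<^sup>2) = 0" using orth p q by simp
  then show ?thesis by simp
qed

section \<open>The form in an eigenbasis\<close>

locale singular_basis =
  fixes m n :: nat and B :: "complex mat" and e :: "nat \<Rightarrow> nat \<Rightarrow> complex" and s :: "nat \<Rightarrow> real"
  assumes B: "B \<in> carrier_mat m n"
    and e: "orthonormal n e"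
    and s_nonneg: "\<forall>p<n. 0 \<le> s p"
    and gram: "\<forall>p<n. \<forall>q<n. cip m (left_singular B e p) (left_singular B e q)
      = (if p = q then of_real ((s p)\<^sup>2) else 0)"
begin

abbreviation "b \<equiv> left_singular B e"

text \<open>The columns in the basis \<open>e\<close> of a matrix of rank at most \<open>k\<close>;
  this is where \<open>k\<close> restricts the available tests.\<close>

definition coord :: "nat \<Rightarrow> (nat \<Rightarrow> nat \<Rightarrow> complex) \<Rightarrow> (nat \<Rightarrow> nat \<Rightarrow> complex) \<Rightarrow> nat \<Rightarrow> nat \<Rightarrow> complex" where
  "coord k v x p a = (\<Sum>j<k. cip n (e p) (v j) * x j a)"

text \<open>Stated for arbitrary columns \<open>z\<close>: sufficiency is proved for all of them,
  while necessity tests those given by \<open>coord\<close>.\<close>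

definition spectral_form :: "real \<Rightarrow> (nat \<Rightarrow> nat \<Rightarrow> complex) \<Rightarrow> complex" where
  "spectral_form \<alpha> z = of_real \<alpha> * (\<Sum>p<n. cip m (z p) (z p))
    + (\<Sum>p<n. \<Sum>q<n. cip m (b q) (z p) * cnj (cip m (b p) (z q)))"

lemma block_form_spectral:
  "block_form m k (\<lambda>i j a b. (if a = b then of_real \<alpha> * (\<Sum>c<n. v j c * cnj (v i c)) else 0)
      + (\<Sum>c<n. B $$ (a, c) * v j c) * cnj (\<Sum>c<n. B $$ (b, c) * v i c)) x
    = spectral_form \<alpha> (coord k v x)"
  using block_form_swapped[OF e, of m k "of_real \<alpha>" v "\<lambda>a c. B $$ (a, c)" x] B
  unfolding spectral_form_def coord_def[abs_def] left_singular_def[abs_def] by simp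

text \<open>Rank one blocks give one direction; conversely the Gram decomposition writes the form of
  any admissible \<open>A\<close> as a sum of spectral forms.\<close>

lemma copositive_iff_spectral:
  "(\<forall>A. psd_blocks n k A \<longrightarrow> psd (block_mat m k (\<lambda>i j. Phi_plus \<alpha> B (A j i)))) \<longleftrightarrow>
    (\<forall>v x. 0 \<le> spectral_form \<alpha> (coord k v x))" (is "?L \<longleftrightarrow> ?R")
proof
  assume L: ?L
  show ?R
  proof (intro allI)
    fix v x :: "nat \<Rightarrow> nat \<Rightarrow> complex"
    let ?A = "\<lambda>i j. mat n n (\<lambda>(c, d). v i c * cnj (v j d))"
    have "psd (block_mat m k (\<lambda>i j. Phi_plus \<alpha> B (?A j i)))"
      using L psd_blocks_rank_one by blast
    then have "0 \<le> block_form m k (\<lambda>i j a b. Phi_plus \<alpha> B (?A j i) $$ (a, b)) x"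
      unfolding psd_block_mat_iff by blast
    \<comment> \<open>A one-term sum over \<open>r\<close>, to match the shape of
      \<open>Phi_plus_index_gram\<close>.\<close>
    also have "block_form m k (\<lambda>i j a b. Phi_plus \<alpha> B (?A j i) $$ (a, b)) x
      = block_form m k (\<lambda>i j a b. \<Sum>r<Suc 0. (if a = b then of_real \<alpha> * (\<Sum>c<n. v j c * cnj (v i c)) else 0)
      + (\<Sum>c<n. B $$ (a, c) * v j c) * cnj (\<Sum>d<n. B $$ (b, d) * v i d)) x"
      by (intro block_form_cong Phi_plus_index_gram[OF B]) auto
    finally show "0 \<le> spectral_form \<alpha> (coord k v x)"
      by (simp only: block_form_sum block_form_spectral) simp
  qed
next
  assume R: ?R
  show ?L
  proof (intro allI impI)
    fix A assume A: "psd_blocks n k A"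
    obtain v :: "nat \<Rightarrow> nat \<Rightarrow> nat \<Rightarrow> complex" where v: "\<And>i j c d. i < k \<Longrightarrow> j < k \<Longrightarrow> c < n \<Longrightarrow> d < n \<Longrightarrow>
         A i j $$ (c, d) = (\<Sum>r<k * n. v r i c * cnj (v r j d))"
      using psd_blocks_gram[OF A] by blast
    have car: "A i j \<in> carrier_mat n n" if "i < k" "j < k" for i j
      using A that by (simp add: psd_blocks_def)
    show "psd (block_mat m k (\<lambda>i j. Phi_plus \<alpha> B (A j i)))" unfolding psd_block_mat_iff
    proof
      fix x
      have "block_form m k (\<lambda>i j a b. Phi_plus \<alpha> B (A j i) $$ (a, b)) x
        = block_form m k (\<lambda>i j a b. \<Sum>r<k * n. (if a = b then of_real \<alpha> * (\<Sum>c<n. v r j c * cnj (v r i c)) else 0)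
        + (\<Sum>c<n. B $$ (a, c) * v r j c) * cnj (\<Sum>d<n. B $$ (b, d) * v r i d)) x"
        by (intro block_form_cong Phi_plus_index_gram[OF B] car v)
      also have "\<dots> = (\<Sum>r<k * n. spectral_form \<alpha> (coord k (v r) x))"
        unfolding block_form_sum block_form_spectral ..
      also have "0 \<le> \<dots>" using R by (intro sum_nonneg) blast
      finally show "0 \<le> block_form m k (\<lambda>i j a b. Phi_plus \<alpha> B (A j i) $$ (a, b)) x" .
    qed
  qed
qed

lemma spectral_form_nonneg:
  assumes \<alpha>: "0 \<le> \<alpha>" and le: "\<forall>p<n. \<forall>q<n. p \<noteq> q \<longrightarrow> s p * s q \<le> \<alpha>"
  shows "0 \<le> spectral_form \<alpha> z"
proof -
  define t where "t p q = cip m (b q) (z p)" for p q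
  define W where "W = (\<Sum>p<n. \<Sum>q<n. t p q * cnj (t q p))"
  define N where "N = (\<Sum>p<n. \<Sum>a<m. (cmod (z p a))\<^sup>2)"
  have form: "spectral_form \<alpha> z = of_real (\<alpha> * N) + W"
    unfolding spectral_form_def t_def[symmetric] W_def[symmetric] N_def cip_self by simp
  \<comment> \<open>Exchanging \<open>p\<close> and \<open>q\<close> conjugates each summand, so the
    double sum is real.\<close>
  have "cnj W = W" unfolding W_def cnj_sum complex_cnj_mult complex_cnj_cnj
    by (subst sum.swap) (simp only: mult.commute)
  then have "Im W = 0" by (simp add: complex_eq_iff)
  moreover have "0 \<le> \<alpha> * N + Re W"
  proof -
    have t0: "t p q = 0" if q: "q < n" and sq: "s q = 0" for p q
    proof -
      have "complex_of_real (\<Sum>a<m. (cmod (b q a))\<^sup>2) = 0"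
        using gram[rule_format, OF q q] sq unfolding cip_self by simp
      then have "(\<Sum>a<m. (cmod (b q a))\<^sup>2) = 0" by (simp only: of_real_eq_0_iff)
      then have "\<forall>a<m. b q a = 0" by (subst (asm) sum_nonneg_eq_0_iff) auto
      then show ?thesis by (simp add: t_def cip_def)
    qed
    have "(\<Sum>p<n. \<Sum>q<n. (cmod (t p q))\<^sup>2 / (s q)\<^sup>2) \<le> N"
      unfolding N_def t_def by (intro sum_mono bessel gram)
    then have "\<alpha> * (\<Sum>p<n. \<Sum>q<n. (cmod (t p q))\<^sup>2 / (s q)\<^sup>2) \<le> \<alpha> * N"
      using \<alpha> by (rule mult_left_mono)
    moreover have "0 \<le> \<alpha> * (\<Sum>p<n. \<Sum>q<n. (cmod (t p q))\<^sup>2 / (s q)\<^sup>2) + Re W"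
      unfolding W_def by (rule pairing_nonneg[OF \<alpha> s_nonneg le]) (use t0 in blast)
    ultimately show ?thesis by simp
  qed
  ultimately show ?thesis unfolding form by (simp add: less_eq_complex_def)
qed

text \<open>For \<open>m \<ge> 2\<close> some nonzero \<open>w\<close> is orthogonal to
  \<open>b 0\<close>. With \<open>w\<close> as column 0 and all others zero, every pairing term
  vanishes and \<open>\<alpha>\<close> times the squared norm of \<open>w\<close> remains.\<close>

lemma spectral_form_nonnegD:
  assumes nn: "\<forall>v x. 0 \<le> spectral_form \<alpha> (coord k v x)" and "2 \<le> m" "0 < n" "0 < k"
  shows "0 \<le> \<alpha>"
proof -
  \<comment> \<open>The vector orthogonal to \<open>b 0\<close> within the first two coordinates, or
    a basis vector if both of these coordinates of \<open>b 0\<close> vanish.\<close>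
  define w :: "nat \<Rightarrow> complex" where "w a = (if b 0 0 = 0 \<and> b 0 1 = 0 then (if a = 0 then 1 else 0)
     else if a = 0 then cnj (b 0 1) else if a = 1 then - cnj (b 0 0) else 0)" for a
  have supp: "(\<Sum>a<m. f a) = f 0 + f 1" if "\<And>a. a \<noteq> 0 \<Longrightarrow> a \<noteq> 1 \<Longrightarrow> f a = 0" for f :: "nat \<Rightarrow> complex"
    by (rule sum_two_support) (use assms that in auto)
  have bw: "cip m (b 0) w = 0"
    unfolding cip_def by (subst supp) (auto simp: w_def)
  have "cip m w w = cnj (w 0) * w 0 + cnj (w 1) * w 1"
    unfolding cip_def by (rule supp) (auto simp: w_def)
  moreover have "w 0 \<noteq> 0 \<or> w 1 \<noteq> 0" by (auto simp: w_def)
  ultimately have "0 < (cmod (w 0))\<^sup>2 + (cmod (w 1))\<^sup>2" and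
    ww: "cip m w w = of_real ((cmod (w 0))\<^sup>2 + (cmod (w 1))\<^sup>2)"
    using complex_norm_square[of "w 0"] complex_norm_square[of "w 1"]
    by (auto simp: mult.commute sum_power2_gt_zero_iff)
  define v where "v i = (if i = 0 then e 0 else (\<lambda>c. 0))" for i :: nat
  define x where "x i = (if i = 0 then w else (\<lambda>a. 0))" for i :: nat
  have z: "coord k v x p = (if p = 0 then w else (\<lambda>a. 0))" if "p < n" for p
  proof
    fix a
    have "coord k v x p a = (\<Sum>j<k. (if j = 0 then 1 else 0) * (cip n (e p) (e 0) * w a))"
      unfolding coord_def by (intro sum.cong refl) (simp add: v_def x_def)
    also have "\<dots> = cip n (e p) (e 0) * w a" by (rule sum_delta_mult(1)[OF \<open>0 < k\<close>])
    finally show "coord k v x p a = (if p = 0 then w else (\<lambda>a. 0)) a"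
      using orthonormalD[OF e that \<open>0 < n\<close>] by simp
  qed
  have "(\<Sum>p<n. cip m (coord k v x p) (coord k v x p)) = (\<Sum>p<n. (if p = 0 then 1 else 0) * cip m w w)"
    by (intro sum.cong refl) (simp add: z cip_def)
  also have "\<dots> = cip m w w" by (rule sum_delta_mult(1)[OF \<open>0 < n\<close>])
  finally have 1: "(\<Sum>p<n. cip m (coord k v x p) (coord k v x p)) = cip m w w" .
  have 2: "cip m (b q) (coord k v x p) * cnj (cip m (b p) (coord k v x q)) = 0" if "p < n" "q < n" for p q
    using bw by (simp add: z[OF that(1)] z[OF that(2)]) (simp add: cip_def)
  have "0 \<le> of_real \<alpha> * cip m w w"
    using nn[rule_format, of v x] unfolding spectral_form_def 1 by (simp add: 2)
  then have "0 \<le> complex_of_real (\<alpha> * ((cmod (w 0))\<^sup>2 + (cmod (w 1))\<^sup>2))"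
    unfolding ww of_real_mult .
  with \<open>0 < (cmod (w 0))\<^sup>2 + (cmod (w 1))\<^sup>2\<close> show ?thesis
    by (simp add: less_eq_complex_def zero_le_mult_iff)
qed

text \<open>Two unit columns give \<open>2 * \<alpha>\<close>. The only nonzero pairings are
  \<open>s q\<close> and \<open>- s p\<close>, whose opposite signs contribute
  \<open>- 2 * s p * s q\<close>. Two independent columns require \<open>k \<ge> 2\<close>.\<close>

lemma spectral_form_bound:
  assumes nn: "\<forall>v x. 0 \<le> spectral_form \<alpha> (coord k v x)" and k: "2 \<le> k"
    and pq: "p < n" "q < n" "p \<noteq> q" and sp: "0 < s p" and sq: "0 < s q"
  shows "s p * s q \<le> \<alpha>"
proof -
  define w0 where "w0 = (\<lambda>a. of_real (1 / s q) * b q a)"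
  define w1 where "w1 = (\<lambda>a. of_real (- 1 / s p) * b p a)"
  note gpq = gram[rule_format, OF pq(1) pq(2)] gram[rule_format, OF pq(2) pq(1)]
    gram[rule_format, OF pq(1) pq(1)] gram[rule_format, OF pq(2) pq(2)]
  have c: "cip m (b p) w0 = 0" "cip m (b q) w0 = of_real (s q)"
    "cip m (b q) w1 = 0" "cip m (b p) w1 = - of_real (s p)"
    "cip m w0 w0 = 1" "cip m w1 w1 = 1"
    unfolding w0_def w1_def cip_scale_right cip_scale_left gpq using pq(3) sp sq
    by (auto simp: power2_eq_square)
  \<comment> \<open>Blocks 0 and 1 place \<open>w0\<close> in column \<open>p\<close> and
    \<open>w1\<close> in column \<open>q\<close>.\<close>
  define v where "v i = (if i = 0 then e p else if i = 1 then e q else (\<lambda>c. 0))" for i :: nat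
  define x where "x i = (if i = 0 then w0 else if i = 1 then w1 else (\<lambda>a. 0))" for i :: nat
  have z: "coord k v x r = (if r = p then w0 else if r = q then w1 else (\<lambda>a. 0))" if r: "r < n" for r
  proof
    fix a
    have "coord k v x r a = cip n (e r) (v 0) * x 0 a + cip n (e r) (v 1) * x 1 a"
      unfolding coord_def by (rule sum_two_support) (use k in \<open>auto simp: x_def\<close>)
    then show "coord k v x r a = (if r = p then w0 else if r = q then w1 else (\<lambda>a. 0)) a"
      using orthonormalD[OF e r pq(1)] orthonormalD[OF e r pq(2)] pq(3) by (simp add: v_def x_def)
  qed
  let ?z = "coord k v x"
  have zp: "?z p = w0" "?z q = w1" using z pq by auto
  have zr: "cip m y (?z r) = 0" "cip m (?z r) y = 0" if "r < n" "r \<noteq> p" "r \<noteq> q" for r y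
    using that by (simp_all add: z cip_def)
  have 1: "(\<Sum>r<n. cip m (?z r) (?z r)) = 2"
    by (subst sum_two_support[OF pq]) (simp_all add: zr zp c)
  have "(\<Sum>r<n. \<Sum>l<n. cip m (b l) (?z r) * cnj (cip m (b r) (?z l)))
      = (\<Sum>r<n. cip m (b p) (?z r) * cnj (cip m (b r) w0) + cip m (b q) (?z r) * cnj (cip m (b r) w1))"
    by (intro sum.cong refl, subst sum_two_support[OF pq]) (simp_all add: zr zp)
  also have "\<dots> = - of_real (2 * (s p * s q))"
    by (subst sum_two_support[OF pq]) (simp_all add: zr zp c)
  finally have "spectral_form \<alpha> ?z = of_real (2 * (\<alpha> - s p * s q))"
    unfolding spectral_form_def 1 by (simp add: algebra_simps)
  with nn[rule_format, of v x] show ?thesis by (simp add: less_eq_complex_def)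
qed

end

section \<open>Equivalence of PPT, copositivity and the singular value bound\<close>

theorem corollary4p11:
  fixes m n k :: nat and \<alpha> :: real and B :: "complex mat"
  assumes "m \<ge> 2" and "n \<ge> 2" and "1 \<le> k" and "k \<le> m"
    and "B \<in> carrier_mat m n"
  shows "(k_PPT n m k (Phi_plus \<alpha> B) \<longleftrightarrow> k_copositive n m k (Phi_plus \<alpha> B)) \<and>
    (k_copositive n m k (Phi_plus \<alpha> B) \<longleftrightarrow>
      (if k = 1 \<or> vec_space.rank m B \<le> 1 then \<alpha> \<ge> 0
       else \<alpha> \<ge> singular_value 1 B * singular_value 2 B))"
proof -
  note B = assms(5)
  note lin = linear_mat_map_Phi_plus[OF B, of \<alpha>]
  obtain e s where e: "orthonormal n e" and s: "\<forall>p<n. 0 \<le> s p"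
    and gram: "\<forall>p<n. \<forall>q<n. cip m (left_singular B e p) (left_singular B e q) = (if p = q then of_real ((s p)\<^sup>2) else 0)"
    and sv: "singular_values B = take (min m n) (rev (sort (map s [0..<n])))"
    using singular_basis_exists[OF B] by (elim exE conjE)
  interpret singular_basis m n B e s
    by unfold_locales (fact B e s gram)+
  \<comment> \<open>As \<open>m\<close> and \<open>n\<close> are at least 2, truncation keeps the
    first two entries; the one-based indices 1 and 2 are list positions 0 and 1.\<close>
  have sv12: "singular_value 1 B * singular_value 2 B
      = rev (sort (map s [0..<n])) ! 0 * rev (sort (map s [0..<n])) ! 1"
    unfolding singular_value_def sv using assms(1,2) by simp
  note top = largest_two_product[OF assms(2) s, folded sv12]
  have copos: "k_copositive n m k (Phi_plus \<alpha> B) \<longleftrightarrow> (\<forall>v x. 0 \<le> spectral_form \<alpha> (coord k v x))"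
    unfolding k_copositive_iff[OF lin] by (rule copositive_iff_spectral)
  have ppt: "k_PPT n m k (Phi_plus \<alpha> B) \<longleftrightarrow>
     (\<forall>A. psd_blocks n k A \<longrightarrow> psd (block_mat m k (\<lambda>i j. Phi_plus \<alpha> B (A i j)))) \<and> k_copositive n m k (Phi_plus \<alpha> B)"
    unfolding k_copositive_iff[OF lin] k_PPT_def PPT_def partial_transpose_def using lin by blast
  let ?iii = "if k = 1 \<or> vec_space.rank m B \<le> 1 then \<alpha> \<ge> 0 else \<alpha> \<ge> singular_value 1 B * singular_value 2 B"
  have nec: "0 \<le> \<alpha>" if "k_copositive n m k (Phi_plus \<alpha> B)"
    using spectral_form_nonnegD[of \<alpha> k] that assms unfolding copos by auto
  have "?iii" if co: "k_copositive n m k (Phi_plus \<alpha> B)"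
  proof (cases "k = 1")
    case False
    with assms have k: "2 \<le> k" by simp
    from top(1) obtain p q where pq: "p < n" "q < n" "p \<noteq> q"
      and eq: "s p * s q = singular_value 1 B * singular_value 2 B" by blast
    have "s p * s q \<le> \<alpha>"
    proof (cases "s p = 0 \<or> s q = 0")
      case False
      then have "0 < s p" "0 < s q" using s pq by (auto simp: less_le)
      then show ?thesis using spectral_form_bound[OF _ k pq] co unfolding copos by blast
    qed (use nec[OF co] in auto)
    \<comment> \<open>For \<open>k \<ge> 2\<close> both candidate bounds hold whatever the rank,
      which covers both branches.\<close>
    then show ?thesis using nec[OF co] eq by simp
  qed (use nec[OF co] in simp)
  moreover have "0 \<le> \<alpha>" if iii: ?iii
  proof -
    from top(1) have "0 \<le> singular_value 1 B * singular_value 2 B"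
      using s by (metis mult_nonneg_nonneg)
    then show ?thesis using iii by (auto split: if_splits)
  qed
  moreover have "k_copositive n m k (Phi_plus \<alpha> B)" if iii: ?iii and \<alpha>: "0 \<le> \<alpha>"
  proof (cases "k = 1")
    case True
    \<comment> \<open>With a single block the swap does nothing, so copositivity reduces to
      positivity.\<close>
    have "block_mat m k (\<lambda>i j. Phi_plus \<alpha> B (A j i)) = block_mat m k (\<lambda>i j. Phi_plus \<alpha> B (A i j))" for A
      unfolding True block_mat_def by (intro eq_matI) auto
    then show ?thesis
      unfolding k_copositive_iff[OF lin] using Phi_plus_k_positive[OF B \<alpha>] by metis
  next
    case False
    have "s p * s q \<le> \<alpha>" if pq: "p < n" "q < n" "p \<noteq> q" for p q
    proof (cases "vec_space.rank m B \<le> 1")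
      case True
      have "s p * s q = 0"
        by (rule rank_le_1_singular[OF B True, of e]) (use gram pq in auto)
      then show ?thesis using \<alpha> by auto
    next
      case rank: False
      then have "singular_value 1 B * singular_value 2 B \<le> \<alpha>" using iii False by simp
      then show ?thesis using top(2) pq by (meson order_trans)
    qed
    then show ?thesis unfolding copos using spectral_form_nonneg[OF \<alpha>] by blast
  qed
  ultimately have "k_copositive n m k (Phi_plus \<alpha> B) \<longleftrightarrow> ?iii" by blast
  moreover have "k_PPT n m k (Phi_plus \<alpha> B) \<longleftrightarrow> k_copositive n m k (Phi_plus \<alpha> B)"
    unfolding ppt using Phi_plus_k_positive[OF B] nec by blast
  ultimately show ?thesis by blast
qed

end
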